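(* For Lebesgue almost every $y\in[0,1)$, $$\lambda_2\Big(\bigcap_{n=1}^{\infty}\bigcup_{i=n}^{\infty} T^{-i}B\big((y,0),\tfrac1i\big)\Big)=1.$$
   Context: Fix an irrational badly approximable $\alpha\in(0,1/3)$ (that is, $\liminf_{n\to\infty} n\,d(n\alpha,\mathbb{Z})>0$). Expressions involving $\alpha$ are interpreted mod 1; in particular $m\alpha$ denotes the representative in $[0,1)$. Let $q_i$ be the denominator of the $i$-th continued fraction convergent of $\alpha$ (indexed with $q_0=1$, so that for even indices $q_{2i}\alpha$ mod 1 equals $d(q_{2i}\alpha,\mathbb{Z})$). Put $c_i=q_{10^i}$ and $b_i=q_{2\cdot 10^i}$ for $i\ge1$. Let $J=[0,\sum_{i=1}^\infty c_i\alpha)$, $y_\infty=\alpha+\sum_{i=1}^\infty b_i\alpha$, and $J'=y_\infty+J$. Define $T:[0,1)\times\mathbb{Z}_2\to[0,1)\times\mathbb{Z}_2$ by $T(x,i)=(x+\alpha,\ i+\chi_{J\cup J'}(x))$. $\lambda_2$ is Lebesgue measure on $[0,1)\times\mathbb{Z}_2$ (total mass $2$). For $j\in\mathbb{Z}_2$ and $r>0$, $B((y,j),r)=\{(x,j): d(x-y,\mathbb{Z})<r\}$. *)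

theory Defs
  imports "HOL-Analysis.Analysis" "HOL-Library.Z2"
begin

definition badly_approximable :: "real \<Rightarrow> bool" where
  "badly_approximable \<alpha> \<longleftrightarrow>
     liminf (\<lambda>n::nat. ereal (real n * infdist (real n * \<alpha>) \<int>)) > 0"

fun cf_complete_quotient :: "real \<Rightarrow> nat \<Rightarrow> real" where
  "cf_complete_quotient \<alpha> 0 = \<alpha>"
| "cf_complete_quotient \<alpha> (Suc n) = 1 / frac (cf_complete_quotient \<alpha> n)"

definition cf_quotient :: "real \<Rightarrow> nat \<Rightarrow> int" where
  "cf_quotient \<alpha> n = \<lfloor>cf_complete_quotient \<alpha> n\<rfloor>"

fun cf_num :: "real \<Rightarrow> nat \<Rightarrow> int" where
  "cf_num \<alpha> 0 = cf_quotient \<alpha> 0"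
| "cf_num \<alpha> (Suc 0) = cf_quotient \<alpha> 1 * cf_quotient \<alpha> 0 + 1"
| "cf_num \<alpha> (Suc (Suc n)) = cf_quotient \<alpha> (Suc (Suc n)) * cf_num \<alpha> (Suc n) + cf_num \<alpha> n"

fun cf_denom :: "real \<Rightarrow> nat \<Rightarrow> int" where
  "cf_denom \<alpha> 0 = 1"
| "cf_denom \<alpha> (Suc 0) = cf_quotient \<alpha> 1"
| "cf_denom \<alpha> (Suc (Suc n)) = cf_quotient \<alpha> (Suc (Suc n)) * cf_denom \<alpha> (Suc n) + cf_denom \<alpha> n"

text \<open>The value of the finite continued fraction [a(0); ..., a(n - 1), t].  The next
  lemmas show that the recurrences above give the numerator and denominator, in lowest terms,
  of the n-th convergent [a(0); ..., a(n)].\<close>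

fun cf_eval :: "(nat \<Rightarrow> int) \<Rightarrow> nat \<Rightarrow> real \<Rightarrow> real" where
  "cf_eval a 0 t = t"
| "cf_eval a (Suc n) t = cf_eval a n (a n + 1 / t)"

definition cf_convergent :: "real \<Rightarrow> nat \<Rightarrow> real" where
  "cf_convergent \<alpha> n = cf_eval (cf_quotient \<alpha>) n (cf_quotient \<alpha> n)"

lemma cf_complete_quotient_irrational:
  assumes "\<alpha> \<notin> \<rat>"
  shows "cf_complete_quotient \<alpha> n \<notin> \<rat>"
proof (induction n)
  case 0
  then show ?case using assms by simp
next
  case (Suc n)
  let ?x = "cf_complete_quotient \<alpha> n"
  show ?case
  proof
    assume "cf_complete_quotient \<alpha> (Suc n) \<in> \<rat>"
    then have "1 / cf_complete_quotient \<alpha> (Suc n) \<in> \<rat>"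
      by (intro Rats_divide Rats_1)
    then have "frac ?x \<in> \<rat>"
      by simp
    then have "frac ?x + of_int \<lfloor>?x\<rfloor> \<in> \<rat>"
      by (intro Rats_add Rats_of_int)
    then show False using Suc by (simp add: frac_def)
  qed
qed

lemma cf_quotient_pos:
  assumes "\<alpha> \<notin> \<rat>"
  shows "cf_quotient \<alpha> (Suc n) > 0"
proof -
  let ?x = "cf_complete_quotient \<alpha> n"
  have "?x \<notin> \<int>"
    using cf_complete_quotient_irrational[OF assms] Ints_subset_Rats by blast
  then have "frac ?x > 0" by simp
  moreover have "frac ?x < 1" by (rule frac_lt_1)
  ultimately have "1 / frac ?x \<ge> 1" by (simp add: field_simps)
  then show ?thesis unfolding cf_quotient_def by (simp add: le_floor_iff)
qed

lemma cf_denom_pos: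
  assumes "\<alpha> \<notin> \<rat>"
  shows "cf_denom \<alpha> n > 0"
  using assms
proof (induction \<alpha> n rule: cf_denom.induct)
  case (3 \<alpha> n)
  then show ?case using cf_quotient_pos[of \<alpha> "Suc n"] by (simp add: add_pos_pos)
qed (use cf_quotient_pos[of _ 0] in simp_all)

lemma cf_eval_eq:
  assumes "\<alpha> \<notin> \<rat>" and "t > 0"
  shows "cf_eval (cf_quotient \<alpha>) (Suc (Suc n)) t =
    (t * cf_num \<alpha> (Suc n) + cf_num \<alpha> n) / (t * cf_denom \<alpha> (Suc n) + cf_denom \<alpha> n)"
  using assms(2)
proof (induction n arbitrary: t)
  case 0
  have "cf_quotient \<alpha> 1 > 0" using cf_quotient_pos[OF assms(1), of 0] by simp
  then have "real_of_int (cf_quotient \<alpha> 1) * t + 1 > 0"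
    using 0 by (simp add: add_pos_pos)
  then show ?case using 0 by (simp add: field_simps)
next
  case (Suc n)
  let ?a = "real_of_int (cf_quotient \<alpha> (Suc (Suc n)))"
  have a: "?a > 0" using cf_quotient_pos[OF assms(1)] by simp
  have q: "real_of_int (cf_denom \<alpha> k) > 0" for k using cf_denom_pos[OF assms(1)] by simp
  let ?s = "?a + 1 / t"
  have s: "?s > 0" using a Suc.prems by (simp add: add_pos_pos)
  have "cf_eval (cf_quotient \<alpha>) (Suc (Suc (Suc n))) t = cf_eval (cf_quotient \<alpha>) (Suc (Suc n)) ?s"
    by simp
  also have "\<dots> = (?s * cf_num \<alpha> (Suc n) + cf_num \<alpha> n) / (?s * cf_denom \<alpha> (Suc n) + cf_denom \<alpha> n)"
    by (rule Suc.IH[OF s])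
  also have "\<dots> = (t * (?s * cf_num \<alpha> (Suc n) + cf_num \<alpha> n)) / (t * (?s * cf_denom \<alpha> (Suc n) + cf_denom \<alpha> n))"
    using Suc.prems by simp
  also have "t * (?s * cf_num \<alpha> (Suc n) + cf_num \<alpha> n) = t * cf_num \<alpha> (Suc (Suc n)) + cf_num \<alpha> (Suc n)"
    using Suc.prems by (simp add: algebra_simps)
  also have "t * (?s * cf_denom \<alpha> (Suc n) + cf_denom \<alpha> n) = t * cf_denom \<alpha> (Suc (Suc n)) + cf_denom \<alpha> (Suc n)"
    using Suc.prems by (simp add: algebra_simps)
  finally show ?case .
qed

lemma cf_convergent_eq:
  assumes "\<alpha> \<notin> \<rat>"
  shows "cf_convergent \<alpha> n = cf_num \<alpha> n / cf_denom \<alpha> n"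
proof -
  consider "n = 0" | "n = 1" | m where "n = Suc (Suc m)"
    by (metis One_nat_def not0_implies_Suc)
  then show ?thesis
  proof cases
    case 2
    have "cf_quotient \<alpha> 1 > 0" using cf_quotient_pos[OF assms, of 0] by simp
    then show ?thesis using 2 by (simp add: cf_convergent_def field_simps)
  next
    case 3
    have "real_of_int (cf_quotient \<alpha> (Suc (Suc m))) > 0" using cf_quotient_pos[OF assms] by simp
    from cf_eval_eq[OF assms this, of m] show ?thesis by (simp add: 3 cf_convergent_def)
  qed (simp add: cf_convergent_def)
qed

lemma coprime_cf_num_denom: "coprime (cf_num \<alpha> n) (cf_denom \<alpha> n)"
proof -
  have det: "cf_num \<alpha> (Suc k) * cf_denom \<alpha> k - cf_num \<alpha> k * cf_denom \<alpha> (Suc k) = (-1) ^ k" for k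
    by (induction k) (simp_all add: algebra_simps)
  show ?thesis
  proof (rule coprimeI)
    fix d assume "d dvd cf_num \<alpha> n" "d dvd cf_denom \<alpha> n"
    then have "d dvd cf_num \<alpha> (Suc n) * cf_denom \<alpha> n - cf_num \<alpha> n * cf_denom \<alpha> (Suc n)"
      by simp
    then have "d dvd (-1) ^ n" using det by simp
    then show "is_unit d" by (cases "even n") simp_all
  qed
qed

definition c_seq :: "real \<Rightarrow> nat \<Rightarrow> int" where
  "c_seq \<alpha> i = cf_denom \<alpha> (10 ^ i)"

definition b_seq :: "real \<Rightarrow> nat \<Rightarrow> int" where
  "b_seq \<alpha> i = cf_denom \<alpha> (2 * 10 ^ i)"

text \<open>The circle is modelled by \<^term>\<open>{0..<1} :: real set\<close> with addition mod 1.  Each term of the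
  series below is the representative in [0,1), and the sums over \<open>i \<ge> 1\<close> are shifted to start at 0.
  The series converge for irrational \<open>\<alpha>\<close>, since the indices 10^i and 2*10^i are even, so that the
  representative of q(n) * \<open>\<alpha>\<close> is its distance to the integers, which is below 1/q(n+1).\<close>

definition arc_J :: "real \<Rightarrow> real set" where
  "arc_J \<alpha> = {0..<frac (\<Sum>i. frac (of_int (c_seq \<alpha> (Suc i)) * \<alpha>))}"

definition y_inf :: "real \<Rightarrow> real" where
  "y_inf \<alpha> = frac (\<alpha> + (\<Sum>i. frac (of_int (b_seq \<alpha> (Suc i)) * \<alpha>)))"

definition arc_J' :: "real \<Rightarrow> real set" where
  "arc_J' \<alpha> = (\<lambda>x. frac (y_inf \<alpha> + x)) ` arc_J \<alpha>"

definition skew_T :: "real \<Rightarrow> real \<times> bit \<Rightarrow> real \<times> bit" where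
  "skew_T \<alpha> = (\<lambda>(x, i). (frac (x + \<alpha>), i + indicator (arc_J \<alpha> \<union> arc_J' \<alpha>) x))"

definition lambda2 :: "(real \<times> bit) measure" where
  "lambda2 = lebesgue_on {0..<1} \<Otimes>\<^sub>M count_space UNIV"

definition fibre_ball :: "real \<times> bit \<Rightarrow> real \<Rightarrow> (real \<times> bit) set" where
  "fibre_ball = (\<lambda>(y, j) r. {(x, j) | x. x \<in> {0..<1} \<and> infdist (x - y) \<int> < r})"

lemma space_lambda2: "space lambda2 = {0..<1} \<times> UNIV"
  by (simp add: lambda2_def space_pair_measure)

lemma emeasure_lambda2_space: "emeasure lambda2 (space lambda2) = 2"
proof -
  have UNIV_bit: "(UNIV :: bit set) = {0, 1}" using bit_not_one_iff by blast
  have "finite (UNIV :: bit set)" "card (UNIV :: bit set) = 2" by (simp_all add: UNIV_bit)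
  interpret C: sigma_finite_measure "count_space (UNIV :: bit set)"
    by (rule sigma_finite_measure_count_space_finite) fact
  have "emeasure lambda2 (space lambda2) =
    emeasure (lebesgue_on {0..<1::real}) {0..<1} * emeasure (count_space (UNIV :: bit set)) UNIV"
    unfolding space_lambda2 unfolding lambda2_def
    by (rule C.emeasure_pair_measure_Times) (simp_all add: sets_restrict_space_iff)
  also have "\<dots> = 2"
    using \<open>finite UNIV\<close> \<open>card UNIV = 2\<close>
    by (simp add: emeasure_restrict_space emeasure_count_space)
  finally show ?thesis .
qed

end

theory Submission
  imports Defs "HOL-Real_Asymp.Real_Asymp"
begin

text \<open>Let \<open>s\<close> be the length of \<open>J\<close>, \<open>Y\<close> the starting point of \<open>J'\<close>, and \<open>n\<^sub>k = 1 + b\<^sub>1 + \<dots> + b\<^sub>k\<close>, so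
  that \<open>n\<^sub>k \<alpha>\<close> tends to \<open>Y\<close> modulo 1.  The cocycle \<open>\<chi>\<^sub>J - \<chi>\<^sub>J(\<cdot> - n\<^sub>k \<alpha>)\<close> is the coboundary of
  \<open>h\<^sub>k(x) = #{1 \<le> j \<le> n\<^sub>k. x - j \<alpha> \<in> J}\<close>.  Outside a set \<open>D\<^sub>k\<close> of very small measure, \<open>h\<^sub>k\<^sub>+\<^sub>1 - h\<^sub>k\<close> is a
  constant: counting \<open>b\<close> consecutive orbit points in an arc of length \<open>m \<alpha>\<close> amounts, up to a constant,
  to counting \<open>m\<close> orbit points in an arc of length \<open>b \<alpha>\<close>.  After subtracting constants, \<open>h\<^sub>k\<close> is
  therefore eventually constant almost everywhere, and its limit \<open>H\<close> has \<open>\<chi>\<^sub>J - \<chi>\<^sub>J\<^sub>'\<close> as its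
  coboundary.  Since \<open>q\<^sub>n\<close> grows at most exponentially, Borel--Cantelli shows that for almost all
  \<open>(y, x)\<close> every late visit \<open>x + i \<alpha>\<close> to the \<open>1/i\<close>-ball around \<open>y\<close> has \<open>H(x + i \<alpha>) = H(y)\<close>, so all
  these visits take place in the same fibre.  There are infinitely many such visits by Vahlen's
  theorem on convergents, hence exactly one of the two points over \<open>x\<close> lies in the limsup set.\<close>

section \<open>Jumps of the floor function\<close>

lemma infdist_Ints_less_iff:
  fixes x :: real
  shows "infdist x \<int> < r \<longleftrightarrow> (\<exists>k::int. \<bar>x - of_int k\<bar> < r)"
proof
  assume "infdist x \<int> < r"
  then have "\<exists>a\<in>\<int>. dist x a < r"
    using cINF_less_iff[of "\<int> :: real set" "dist x" r]
    by (auto simp: infdist_def split: if_splits)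
  then show "\<exists>k::int. \<bar>x - of_int k\<bar> < r" by (auto simp: dist_real_def elim!: Ints_cases)
next
  assume "\<exists>k::int. \<bar>x - of_int k\<bar> < r"
  then obtain k :: int where "\<bar>x - of_int k\<bar> < r" by blast
  moreover have "infdist x \<int> \<le> dist x (of_int k)" by (rule infdist_le) simp
  ultimately show "infdist x \<int> < r" by (simp add: dist_real_def)
qed

lemma infdist_Ints_add_int:
  fixes x :: real
  shows "infdist (x + of_int k) \<int> = infdist x \<int>"
proof -
  have le: "infdist (x + of_int k) \<int> \<le> infdist x \<int>" for x :: real and k :: int
  proof (rule field_le_epsilon)
    fix e :: real assume "0 < e"
    then have "infdist x \<int> < infdist x \<int> + e" by simp
    then obtain m :: int where "\<bar>x - of_int m\<bar> < infdist x \<int> + e"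
      unfolding infdist_Ints_less_iff by blast
    then have "\<bar>x + of_int k - of_int (m + k)\<bar> < infdist x \<int> + e" by simp
    then have "infdist (x + of_int k) \<int> < infdist x \<int> + e" unfolding infdist_Ints_less_iff by blast
    then show "infdist (x + of_int k) \<int> \<le> infdist x \<int> + e" by simp
  qed
  show ?thesis using le[of x k] le[of "x + of_int k" "- k"] by simp
qed

text \<open>For 0 \<le> \<beta> \<le> 1 this is the indicator of the arc [0, \<beta>) modulo 1.
  Floors turn orbit counts into differences within one integer sequence.\<close>

definition jump :: "real \<Rightarrow> real \<Rightarrow> int" where
  "jump \<beta> x = \<lfloor>x\<rfloor> - \<lfloor>x - \<beta>\<rfloor>"

lemma jump_add_int: "jump \<beta> (x + of_int k) = jump \<beta> x"
proof -
  have "x + of_int k - \<beta> = x - \<beta> + of_int k" by simp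
  then show ?thesis by (simp only: jump_def floor_add_int[symmetric])
qed

lemma measurable_jump [measurable]: "jump \<beta> \<in> borel \<rightarrow>\<^sub>M count_space UNIV"
  unfolding jump_def by measurable

lemma emeasure_jump_le:
  assumes "0 \<le> \<delta>"
  shows "emeasure lborel {x\<in>{0..<1}. jump \<delta> (x - z) \<noteq> 0} \<le> ennreal \<delta>"
proof (cases "\<delta> \<le> 1")
  case True
  define c where "c = frac z"
  have c: "0 \<le> c" "c < 1" by (simp_all add: c_def frac_lt_1)
  \<comment> \<open>A nonzero jump forces x into the arc of length \<delta> starting at z; the
    second interval is the part that wraps around at 1.\<close>
  have "{x\<in>{0..<1}. jump \<delta> (x - z) \<noteq> 0} \<subseteq> {c..<min 1 (c + \<delta>)} \<union> {0..<max 0 (c + \<delta> - 1)}"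
  proof
    fix x assume "x \<in> {x\<in>{0..<1}. jump \<delta> (x - z) \<noteq> 0}"
    then have x: "0 \<le> x" "x < 1" "\<lfloor>x - z\<rfloor> \<noteq> \<lfloor>x - z - \<delta>\<rfloor>" by (auto simp: jump_def)
    define k where "k = \<lfloor>x - z\<rfloor> + \<lfloor>z\<rfloor>"
    have "\<lfloor>x - z - \<delta>\<rfloor> \<le> \<lfloor>x - z\<rfloor>" using assms by (intro floor_mono) simp
    then have *: "x - z - \<delta> < of_int \<lfloor>x - z\<rfloor>" using x(3) by (simp add: floor_less_iff[symmetric])
    have k: "c + of_int k \<le> x" "x < c + of_int k + \<delta>"
      using * of_int_floor_le[of "x - z"] unfolding c_def k_def frac_def of_int_add by linarith+
    have "of_int k < (1::real)" "of_int k > (-2::real)" using k x c True by linarith+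
    then have "k = 0 \<or> k = -1" by linarith
    then show "x \<in> {c..<min 1 (c + \<delta>)} \<union> {0..<max 0 (c + \<delta> - 1)}" using k x by auto
  qed
  then have "emeasure lborel {x\<in>{0..<1}. jump \<delta> (x - z) \<noteq> 0}
      \<le> emeasure lborel ({c..<min 1 (c + \<delta>)} \<union> {0..<max 0 (c + \<delta> - 1)})"
    by (rule emeasure_mono) auto
  also have "\<dots> \<le> emeasure lborel {c..<min 1 (c + \<delta>)} + emeasure lborel {0..<max 0 (c + \<delta> - 1)}"
    by (rule emeasure_subadditive) auto
  also have "\<dots> = ennreal (min 1 (c + \<delta>) - c) + ennreal (max 0 (c + \<delta> - 1))"
    using c assms by simp
  also have "\<dots> = ennreal \<delta>"
    using c assms by (auto simp: min_def max_def ennreal_plus[symmetric] simp del: ennreal_plus)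
  finally show ?thesis .
next
  case False
  have "emeasure lborel {x\<in>{0..<1}. jump \<delta> (x - z) \<noteq> 0} \<le> emeasure lborel {0..<1::real}"
    by (rule emeasure_mono) auto
  also have "\<dots> = ennreal 1" by simp
  also have "\<dots> \<le> ennreal \<delta>" using False by (intro ennreal_leI) simp
  finally show ?thesis .
qed

text \<open>A ball of radius r is contained, after a shift by r, in an arc of length 2r, so measure
  bounds for arcs carry over to balls.\<close>

lemma jump_neq_0_if_near:
  assumes "infdist x \<int> < r"
  shows "jump (2 * r) (x + r) \<noteq> 0"
proof -
  obtain k :: int where "\<bar>x - of_int k\<bar> < r" using assms unfolding infdist_Ints_less_iff by blast
  then have "of_int k \<le> x + r" "x - r < of_int k" by linarith+
  then have "k \<le> \<lfloor>x + r\<rfloor>" "\<lfloor>x + r - 2 * r\<rfloor> < k" by (simp_all add: le_floor_iff floor_less_iff)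
  then show ?thesis by (simp add: jump_def)
qed

lemma emeasure_near_le:
  fixes z :: real
  assumes "0 \<le> r"
  shows "emeasure lborel {x\<in>{0..<1}. infdist (x - z) \<int> < r} \<le> ennreal (2 * r)"
proof -
  have "{x\<in>{0..<1}. infdist (x - z) \<int> < r} \<subseteq> {x\<in>{0..<1}. jump (2 * r) (x - (z - r)) \<noteq> 0}"
    using jump_neq_0_if_near[of "_ - z" r] by (auto simp: algebra_simps)
  then have "emeasure lborel {x\<in>{0..<1}. infdist (x - z) \<int> < r}
      \<le> emeasure lborel {x\<in>{0..<1}. jump (2 * r) (x - (z - r)) \<noteq> 0}"
    by (rule emeasure_mono) measurable
  also have "\<dots> \<le> ennreal (2 * r)" using assms by (intro emeasure_jump_le) simp
  finally show ?thesis .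
qed

text \<open>If the floors differ, some integer lies between the two points and hence within |x - y|
  of y.\<close>

lemma floor_eq_if_far:
  assumes "\<bar>x - y\<bar> < r" "\<not> infdist y \<int> < r"
  shows "\<lfloor>x\<rfloor> = \<lfloor>y::real\<rfloor>"
proof (rule ccontr)
  assume ne: "\<lfloor>x\<rfloor> \<noteq> \<lfloor>y\<rfloor>"
  have "\<exists>k::int. \<bar>y - of_int k\<bar> \<le> \<bar>x - y\<bar>"
  proof (cases "\<lfloor>x\<rfloor> < \<lfloor>y\<rfloor>")
    case True
    then have "x < of_int \<lfloor>y\<rfloor>" by (simp add: floor_less_iff)
    then have "\<bar>y - of_int \<lfloor>y\<rfloor>\<bar> \<le> \<bar>x - y\<bar>" by linarith
    then show ?thesis ..
  next
    case False
    then have "\<lfloor>y\<rfloor> < \<lfloor>x\<rfloor>" using ne by simp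
    then have "y < of_int \<lfloor>x\<rfloor>" by (simp add: floor_less_iff)
    then have "\<bar>y - of_int \<lfloor>x\<rfloor>\<bar> \<le> \<bar>x - y\<bar>" by linarith
    then show ?thesis ..
  qed
  then show False using assms unfolding infdist_Ints_less_iff by (meson le_less_trans)
qed

lemma jump_eq_if_far:
  assumes "infdist (x - y) \<int> < r" "\<not> infdist y \<int> < r" "\<not> infdist (y - \<beta>) \<int> < r"
  shows "jump \<beta> x = jump \<beta> y"
proof -
  obtain k :: int where k: "\<bar>x - y - of_int k\<bar> < r"
    using assms(1) unfolding infdist_Ints_less_iff by blast
  have "\<lfloor>x - of_int k\<rfloor> = \<lfloor>y\<rfloor>" "\<lfloor>x - of_int k - \<beta>\<rfloor> = \<lfloor>y - \<beta>\<rfloor>"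
    using k assms(2,3) by (intro floor_eq_if_far[of _ _ r]; simp add: algebra_simps)+
  then have "jump \<beta> (x - of_int k) = jump \<beta> y" by (simp add: jump_def)
  then show ?thesis using jump_add_int[of \<beta> "x - of_int k" k] by simp
qed

text \<open>Both sides equal the sum of G(j + l) - G(j + l + 1) over all j < b and l < m. This
  exchanges the number of orbit points with the length of the arc.\<close>

lemma sum_shift_exchange:
  fixes G :: "nat \<Rightarrow> int"
  shows "(\<Sum>j<b. G j - G (j + m)) = (\<Sum>l<m. G l - G (l + b))"
proof (induction b)
  case (Suc b)
  have "(\<Sum>l<m. G (l + b) - G (l + Suc b)) = G b - G (b + m)" by (induction m) (simp_all add: add.commute)
  moreover have "(\<Sum>l<m. G l - G (l + Suc b)) = (\<Sum>l<m. G l - G (l + b)) + (\<Sum>l<m. G (l + b) - G (l + Suc b))"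
    by (simp add: sum.distrib[symmetric])
  ultimately show ?case using Suc by simp
qed simp

text \<open>Pick \<open>n \<in> {1..q}\<close> with \<open>n p \<equiv> round (q \<gamma>)\<close> modulo \<open>q\<close>.\<close>
lemma inhomogeneous_approx:
  fixes p q :: int and \<alpha> \<gamma> :: real
  assumes "coprime p q" "q > 0" "of_int q * \<bar>of_int q * \<alpha> - of_int p\<bar> < 1/2"
  shows "\<exists>n::nat. 1 \<le> n \<and> int n \<le> q \<and> infdist (real n * \<alpha> - \<gamma>) \<int> < 1 / of_int q"
proof -
  define N where "N = round (of_int q * \<gamma>)"
  have N: "\<bar>of_int N - of_int q * \<gamma>\<bar> \<le> 1/2" unfolding N_def by (rule of_int_round_abs_le)
  obtain u v where uv: "u * p + v * q = 1"
    using bezout_int[of p q] assms(1) by (auto simp: coprime_iff_gcd_eq_1)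
  define n0 where "n0 = (u * N - 1) mod q + 1"
  have n0: "1 \<le> n0" "n0 \<le> q" using assms(2) pos_mod_sign[of q "u * N - 1"] pos_mod_bound[of q "u * N - 1"]
    unfolding n0_def by linarith+
  have "q dvd (u * N - 1) mod q - (u * N - 1)"
    by (metis dvd_minus_mod dvd_minus_iff minus_diff_eq)
  then obtain w where w: "n0 = u * N + q * w" by (auto simp: n0_def dvd_def algebra_simps)
  have "n0 * p - N = q * (w * p - v * N)"
  proof -
    have "u * N * p = N - v * q * N" using arg_cong[OF uv, of "\<lambda>t. t * N"] by (simp add: algebra_simps)
    then show ?thesis by (simp add: w algebra_simps)
  qed
  then obtain k where k: "n0 * p = N + q * k" by (metis add.commute diff_add_cancel)
  let ?n = "of_int n0 :: real" and ?q = "of_int q :: real" and ?p = "of_int p :: real"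
  have q: "?q > 0" using assms(2) by simp
  have kr: "?n * ?p = of_int N + ?q * of_int k" by (metis k of_int_add of_int_mult)
  \<comment> \<open>The first summand is below 1/2 because n \<le> q, the second is a rounding error
    of at most 1/2.\<close>
  have "?q * (?n * \<alpha> - \<gamma> - of_int k) = ?n * (?q * \<alpha> - ?p) + (of_int N - ?q * \<gamma>)"
    using kr by (simp add: algebra_simps)
  then have "?q * \<bar>?n * \<alpha> - \<gamma> - of_int k\<bar> = \<bar>?n * (?q * \<alpha> - ?p) + (of_int N - ?q * \<gamma>)\<bar>"
    using q by (metis abs_mult abs_of_pos)
  also have "\<dots> \<le> ?n * \<bar>?q * \<alpha> - ?p\<bar> + \<bar>of_int N - ?q * \<gamma>\<bar>"
    using abs_triangle_ineq[of "?n * (?q * \<alpha> - ?p)" "of_int N - ?q * \<gamma>"] n0 by (simp add: abs_mult)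
  also have "\<dots> \<le> ?q * \<bar>?q * \<alpha> - ?p\<bar> + 1/2"
    using N n0 by (intro add_mono mult_right_mono) auto
  also have "\<dots> < 1" using assms(3) by simp
  finally have "\<bar>?n * \<alpha> - \<gamma> - of_int k\<bar> < 1 / ?q" using q by (simp add: field_simps)
  then have "infdist (real (nat n0) * \<alpha> - \<gamma>) \<int> < 1 / ?q"
    using n0 unfolding infdist_Ints_less_iff by auto
  then show ?thesis using n0 by (intro exI[of _ "nat n0"]) auto
qed

section \<open>Continued fractions and inhomogeneous approximation\<close>

definition cf_err :: "real \<Rightarrow> nat \<Rightarrow> real" where
  "cf_err \<alpha> n = of_int (cf_denom \<alpha> n) * \<alpha> - of_int (cf_num \<alpha> n)"

text \<open>The errors satisfy the recurrence of the denominators. Writing each partial quotient as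
  complete quotient minus fractional part, the induction hypothesis cancels everything but the
  fractional part.\<close>

lemma cf_err_Suc:
  assumes "\<alpha> \<notin> \<rat>"
  shows "cf_err \<alpha> n = - cf_complete_quotient \<alpha> (Suc (Suc n)) * cf_err \<alpha> (Suc n)"
proof -
  let ?x = "cf_complete_quotient \<alpha>"
  have frac_pos: "frac (?x n) \<noteq> 0" for n
    using cf_complete_quotient_irrational[OF assms, of n] Ints_subset_Rats by auto
  have quot: "of_int (cf_quotient \<alpha> n) = ?x n - frac (?x n)" for n
    by (simp add: cf_quotient_def frac_def)
  show ?thesis
  proof (induction n)
    case 0
    define f where "f = frac \<alpha>"
    define g where "g = frac (1 / f)"
    have 0: "cf_err \<alpha> 0 = f" using quot[of 0] by (simp add: cf_err_def f_def)
    have "cf_err \<alpha> (Suc 0) = of_int (cf_quotient \<alpha> 1) * cf_err \<alpha> 0 - 1"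
      by (simp add: cf_err_def algebra_simps)
    also have "\<dots> = (1 / f - g) * f - 1" using quot[of 1] 0 by (simp add: f_def g_def)
    also have "\<dots> = - g * f" using frac_pos[of 0] by (simp add: f_def algebra_simps)
    finally show ?case using frac_pos[of 1] 0 by (simp add: f_def g_def)
  next
    case (Suc n)
    have "cf_err \<alpha> (Suc (Suc n)) = of_int (cf_quotient \<alpha> (Suc (Suc n))) * cf_err \<alpha> (Suc n) + cf_err \<alpha> n"
      by (simp add: cf_err_def algebra_simps)
    also have "\<dots> = - frac (?x (Suc (Suc n))) * cf_err \<alpha> (Suc n)"
      unfolding quot Suc by (simp add: algebra_simps)
    finally show ?case using frac_pos[of "Suc (Suc n)"] by (simp del: cf_complete_quotient.simps(2) add: cf_complete_quotient.simps(2)[of \<alpha> "Suc (Suc n)"])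
  qed
qed

context
  fixes \<alpha> :: real
  assumes irr: "\<alpha> \<notin> \<rat>"
begin

lemma cf_complete_quotient_gt_1: "cf_complete_quotient \<alpha> (Suc n) > 1"
proof -
  have "frac (cf_complete_quotient \<alpha> n) > 0" "frac (cf_complete_quotient \<alpha> n) < 1"
    using cf_complete_quotient_irrational[OF irr, of n] Ints_subset_Rats by (auto simp: frac_lt_1)
  then show ?thesis by (simp add: field_simps)
qed

lemma cf_err_sign: "(-1) ^ n * cf_err \<alpha> n > 0"
proof (induction n)
  case 0
  have "frac \<alpha> > 0" using irr Ints_subset_Rats by auto
  then show ?case by (simp add: cf_err_def cf_quotient_def frac_def)
next
  case (Suc n)
  have "(-1) ^ n * cf_err \<alpha> n = cf_complete_quotient \<alpha> (Suc (Suc n)) * ((-1) ^ Suc n * cf_err \<alpha> (Suc n))"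
    using cf_err_Suc[OF irr, of n] by simp
  then show ?case using Suc cf_complete_quotient_gt_1[of "Suc n"]
    by (metis less_trans zero_less_mult_pos zero_less_one)
qed

lemma abs_cf_err: "\<bar>cf_err \<alpha> n\<bar> = (-1) ^ n * cf_err \<alpha> n"
  using cf_err_sign[of n] by (cases "even n") auto

lemma cf_err_even_pos: "even n \<Longrightarrow> cf_err \<alpha> n > 0"
  using cf_err_sign[of n] by simp

text \<open>Since the signs alternate, the recurrence subtracts at least one copy of the error at n
  + 1, which is no smaller than the error at n + 2.\<close>

lemma abs_cf_err_Suc_Suc: "\<bar>cf_err \<alpha> (Suc (Suc n))\<bar> \<le> \<bar>cf_err \<alpha> n\<bar> / 2"
proof -
  let ?e = "\<lambda>n. \<bar>cf_err \<alpha> n\<bar>"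
  have e: "?e n = cf_complete_quotient \<alpha> (Suc (Suc n)) * ?e (Suc n)" for n
    using cf_err_Suc[OF irr, of n] cf_complete_quotient_gt_1[of "Suc n"] by (simp add: abs_mult)
  have mono: "?e (Suc n) \<le> ?e n" for n
    using cf_complete_quotient_gt_1[of "Suc n"] mult_right_mono[of 1 "cf_complete_quotient \<alpha> (Suc (Suc n))" "?e (Suc n)"]
    unfolding e[of n] by simp
  have "cf_err \<alpha> (Suc (Suc n)) = of_int (cf_quotient \<alpha> (Suc (Suc n))) * cf_err \<alpha> (Suc n) + cf_err \<alpha> n"
    by (simp add: cf_err_def algebra_simps)
  then have "?e (Suc (Suc n)) = ?e n - of_int (cf_quotient \<alpha> (Suc (Suc n))) * ?e (Suc n)"
    unfolding abs_cf_err by (simp add: algebra_simps)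
  moreover have "?e (Suc n) \<le> of_int (cf_quotient \<alpha> (Suc (Suc n))) * ?e (Suc n)"
    using cf_quotient_pos[OF irr, of "Suc n"] mult_right_mono[of 1 "of_int (cf_quotient \<alpha> (Suc (Suc n)))" "?e (Suc n)"]
    by simp
  ultimately show ?thesis using mono[of "Suc n"] by simp
qed

lemma abs_cf_err_add: "\<bar>cf_err \<alpha> (n + 2 * k)\<bar> \<le> \<bar>cf_err \<alpha> n\<bar> / 2 ^ k"
proof (induction k)
  case (Suc k)
  have "\<bar>cf_err \<alpha> (n + 2 * Suc k)\<bar> \<le> \<bar>cf_err \<alpha> (n + 2 * k)\<bar> / 2"
    using abs_cf_err_Suc_Suc[of "n + 2 * k"] by simp
  then show ?case using Suc by simp
qed simp

text \<open>The determinant identity for consecutive convergents, expressed by errors; their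
  alternating signs make both terms positive.\<close>

lemma cf_err_det:
  "of_int (cf_denom \<alpha> n) * \<bar>cf_err \<alpha> (Suc n)\<bar> + of_int (cf_denom \<alpha> (Suc n)) * \<bar>cf_err \<alpha> n\<bar> = 1"
proof -
  have "cf_num \<alpha> (Suc n) * cf_denom \<alpha> n - cf_num \<alpha> n * cf_denom \<alpha> (Suc n) = (-1) ^ n"
    by (induction n) (simp_all add: algebra_simps)
  then have "real_of_int (cf_num \<alpha> (Suc n) * cf_denom \<alpha> n - cf_num \<alpha> n * cf_denom \<alpha> (Suc n)) = (-1) ^ n"
    by simp
  then show ?thesis unfolding abs_cf_err
    by (cases "even n") (simp_all add: cf_err_def algebra_simps)
qed

section \<open>Growth of the denominators against decay of the errors\<close>

lemma cf_denom_mono: "cf_denom \<alpha> n \<le> cf_denom \<alpha> (Suc n)"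
proof (cases n)
  case 0
  then show ?thesis using cf_quotient_pos[OF irr, of 0] by simp
next
  case (Suc m)
  have "1 * cf_denom \<alpha> (Suc m) \<le> cf_quotient \<alpha> (Suc (Suc m)) * cf_denom \<alpha> (Suc m)"
    using cf_quotient_pos[OF irr, of "Suc m"] cf_denom_pos[OF irr, of "Suc m"] by (intro mult_right_mono) auto
  then show ?thesis using cf_denom_pos[OF irr, of m] Suc by simp
qed

lemma mono_cf_denom: "m \<le> n \<Longrightarrow> cf_denom \<alpha> m \<le> cf_denom \<alpha> n"
  using lift_Suc_mono_le[of "cf_denom \<alpha>"] cf_denom_mono by blast

lemma cf_denom_Suc_Suc: "2 * cf_denom \<alpha> n \<le> cf_denom \<alpha> (Suc (Suc n))"
proof -
  have "1 * cf_denom \<alpha> (Suc n) \<le> cf_quotient \<alpha> (Suc (Suc n)) * cf_denom \<alpha> (Suc n)"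
    using cf_quotient_pos[OF irr, of "Suc n"] cf_denom_pos[OF irr, of "Suc n"] by (intro mult_right_mono) auto
  then show ?thesis using cf_denom_mono[of n] by simp
qed

lemma cf_denom_add: "2 ^ k * cf_denom \<alpha> n \<le> cf_denom \<alpha> (n + 2 * k)"
proof (induction k)
  case (Suc k)
  then show ?case using cf_denom_Suc_Suc[of "n + 2 * k"] by simp
qed simp

lemma cf_denom_err_le: "of_int (cf_denom \<alpha> n) * \<bar>cf_err \<alpha> n\<bar> \<le> 1"
proof -
  have "of_int (cf_denom \<alpha> n) * \<bar>cf_err \<alpha> n\<bar> \<le> of_int (cf_denom \<alpha> (Suc n)) * \<bar>cf_err \<alpha> n\<bar>"
    using cf_denom_mono[of n] by (intro mult_right_mono) auto
  also have "\<dots> \<le> 1" using cf_err_det[of n] cf_denom_pos[OF irr, of n]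
    by (smt (verit) mult_nonneg_nonneg of_int_0_le_iff abs_ge_zero)
  finally show ?thesis .
qed

text \<open>The main quantitative tool: a wide gap between two indices makes the product of the
  earlier denominator and the later error exponentially small.\<close>

lemma cf_denom_err_add: "of_int (cf_denom \<alpha> n) * \<bar>cf_err \<alpha> (n + 2 * k)\<bar> \<le> 1 / 2 ^ k"
proof -
  have "of_int (cf_denom \<alpha> n) * \<bar>cf_err \<alpha> (n + 2 * k)\<bar> \<le> of_int (cf_denom \<alpha> n) * (\<bar>cf_err \<alpha> n\<bar> / 2 ^ k)"
    using abs_cf_err_add[of n k] cf_denom_pos[OF irr, of n] by (intro mult_left_mono) auto
  also have "\<dots> \<le> 1 / 2 ^ k" using cf_denom_err_le[of n] by (simp add: divide_right_mono)
  finally show ?thesis .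
qed

lemma frac_cf_denom:
  assumes "even n" "\<alpha> \<in> {0<..<1}"
  shows "frac (of_int (cf_denom \<alpha> n) * \<alpha>) = cf_err \<alpha> n"
proof -
  have "\<bar>cf_err \<alpha> n\<bar> < 1"
  proof -
    obtain k where "n = 0 + 2 * k" using assms(1) by auto
    then have "\<bar>cf_err \<alpha> n\<bar> \<le> \<bar>cf_err \<alpha> 0\<bar> / 2 ^ k" using abs_cf_err_add[of 0 k] by simp
    also have "\<dots> \<le> \<bar>cf_err \<alpha> 0\<bar> / 1" by (intro divide_left_mono) auto
    also have "\<dots> < 1" using assms(2) floor_eq_iff[of \<alpha> 0] by (simp add: cf_err_def cf_quotient_def)
    finally show ?thesis .
  qed
  then show ?thesis using cf_err_even_pos[OF assms(1)]
    by (intro frac_unique_iff[THEN iffD2]) (auto simp: cf_err_def)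
qed

text \<open>Vahlen: of two consecutive convergents, one satisfies \<open>q \<bar>q \<alpha> - p\<bar> < 1/2\<close>.\<close>
lemma ex_good_convergent:
  assumes "n \<ge> 1"
  shows "\<exists>k\<ge>n. of_int (cf_denom \<alpha> k) * \<bar>cf_err \<alpha> k\<bar> < 1/2"
proof (rule ccontr)
  assume neg: "\<not> ?thesis"
  define a b u v :: real where "a = of_int (cf_denom \<alpha> n)" and "b = of_int (cf_denom \<alpha> (Suc n))"
    and "u = \<bar>cf_err \<alpha> n\<bar>" and "v = \<bar>cf_err \<alpha> (Suc n)\<bar>"
  have *: "a * u \<ge> 1/2" "b * v \<ge> 1/2" using neg by (auto simp: a_def b_def u_def v_def not_less simp del: cf_denom.simps)
  have det: "a * v + b * u = 1" unfolding a_def b_def u_def v_def by (rule cf_err_det)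
  have ab: "a > 0" "b > a"
  proof -
    show "a > 0" using cf_denom_pos[OF irr] by (simp add: a_def)
    obtain m where m: "n = Suc m" using assms by (cases n) auto
    have "1 * cf_denom \<alpha> n \<le> cf_quotient \<alpha> (Suc n) * cf_denom \<alpha> n"
      using cf_quotient_pos[OF irr, of n] cf_denom_pos[OF irr, of n] by (intro mult_right_mono) auto
    then have "cf_denom \<alpha> n < cf_denom \<alpha> (Suc n)" using cf_denom_pos[OF irr, of m] by (simp add: m)
    then show "b > a" unfolding a_def b_def of_int_less_iff .
  qed
  \<comment> \<open>With au and bv at least 1/2, the determinant identity times ab yields ab \<ge>
    (a^2 + b^2)/2, which is impossible for a < b.\<close>
  have "a * b * (a * v + b * u) = a * b" by (simp add: det)
  moreover have "a * b * (a * v + b * u) = a\<^sup>2 * (b * v) + b\<^sup>2 * (a * u)"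
    by (simp add: power2_eq_square algebra_simps)
  moreover have "a\<^sup>2 * (b * v) \<ge> a\<^sup>2 * (1/2)" "b\<^sup>2 * (a * u) \<ge> b\<^sup>2 * (1/2)"
    using * by (intro mult_left_mono; simp)+
  ultimately have "(b - a)\<^sup>2 \<le> 0" by (simp add: power2_eq_square algebra_simps)
  then show False using ab by simp
qed

text \<open>If there were finitely many hits, their distances would have a positive minimum d, as
  \<gamma> is not on the orbit. A good convergent with denominator q > 1/d gives n \<le> q at
  distance below 1/q, a hit closer than d.\<close>

lemma infinitely_many_hits:
  assumes "\<And>i k. \<gamma> \<noteq> of_int i * \<alpha> + of_int k"
  shows "\<exists>\<^sub>\<infinity>n::nat. n \<ge> 1 \<and> infdist (real n * \<alpha> - \<gamma>) \<int> < 1 / real n"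
proof (rule ccontr)
  assume neg: "\<not> ?thesis"
  define S where "S = {n::nat. n \<ge> 1 \<and> infdist (real n * \<alpha> - \<gamma>) \<int> < 1 / real n}"
  have fin: "finite S" using neg by (simp add: S_def frequently_cofinite)
  have pos: "infdist (real n * \<alpha> - \<gamma>) \<int> > 0" for n
  proof -
    have "real n * \<alpha> - \<gamma> \<notin> \<int>"
    proof
      assume "real n * \<alpha> - \<gamma> \<in> \<int>"
      then obtain k where "real n * \<alpha> - \<gamma> = of_int k" by (auto elim: Ints_cases)
      then have "\<gamma> = of_int (int n) * \<alpha> + of_int (- k)" by simp
      then show False using assms by blast
    qed
    then show ?thesis using infdist_pos_not_in_closed[of "\<int>" "real n * \<alpha> - \<gamma>"] by auto
  qed
  \<comment> \<open>The inserted 1 keeps the minimum meaningful if there are no hits.\<close>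
  define d where "d = Min (insert 1 ((\<lambda>n. infdist (real n * \<alpha> - \<gamma>) \<int>) ` S))"
  have d: "d > 0" "\<And>n. n \<in> S \<Longrightarrow> d \<le> infdist (real n * \<alpha> - \<gamma>) \<int>"
    using fin pos by (auto simp: d_def Min_le_iff)
  obtain N where N: "1 / d < 2 ^ N" using real_arch_pow[of 2 "1/d"] by auto
  from ex_good_convergent[of "Suc (2 * N)"]
  obtain k where k: "k \<ge> Suc (2 * N)" "of_int (cf_denom \<alpha> k) * \<bar>cf_err \<alpha> k\<bar> < 1/2"
    by (metis le_add1 plus_1_eq_Suc)
  let ?q = "cf_denom \<alpha> k"
  have "2 ^ N * 1 \<le> cf_denom \<alpha> (0 + 2 * N)" using cf_denom_add[of N 0] by simp
  also have "\<dots> \<le> ?q" using k(1) by (intro mono_cf_denom) auto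
  finally have "real_of_int (2 ^ N) \<le> of_int ?q" by (simp only: of_int_le_iff)
  then have q: "1 / d < of_int ?q" using N by (simp only: of_int_power of_int_numeral)
  have "coprime (cf_num \<alpha> k) ?q" by (rule coprime_cf_num_denom)
  from inhomogeneous_approx[OF this cf_denom_pos[OF irr] k(2)[unfolded cf_err_def], of \<gamma>]
  obtain n :: nat where n: "1 \<le> n" "int n \<le> ?q" "infdist (real n * \<alpha> - \<gamma>) \<int> < 1 / of_int ?q"
    by metis
  have "real n \<le> of_int ?q" using n(2) by (metis of_int_le_iff of_int_of_nat_eq)
  then have "1 / of_int ?q \<le> 1 / real n" using n(1) by (intro divide_left_mono) auto
  then have "n \<in> S" using n(1,3) by (simp add: S_def)
  then have "d < 1 / of_int ?q" using d(2)[of n] n(3) by simp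
  then show False using q d(1) less_imp_inverse_less[OF q] by (simp add: inverse_eq_divide)
qed

text \<open>Write q(n) for the denominators and e(n) for the absolute errors. Bad approximability
  gives c < q(n) e(n) for large n, and q(n+1) e(n) \<le> 1 by the determinant identity, so q(n+1)
  \<le> q(n)/c.\<close>

lemma cf_denom_growth:
  assumes "badly_approximable \<alpha>"
  shows "\<exists>C\<ge>0. \<forall>n. ln (of_int (cf_denom \<alpha> n)) \<le> C * real n"
proof -
  obtain c' where c': "0 < c'" "c' < liminf (\<lambda>n::nat. ereal (real n * infdist (real n * \<alpha>) \<int>))"
    using assms dense unfolding badly_approximable_def by blast
  then obtain c where c: "c' = ereal c" by (cases c') auto
  have "eventually (\<lambda>n::nat. ereal c < ereal (real n * infdist (real n * \<alpha>) \<int>)) sequentially"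
    using less_LiminfD[OF c'(2)] unfolding c .
  then obtain N :: nat where N: "\<And>n. n \<ge> N \<Longrightarrow> c < real n * infdist (real n * \<alpha>) \<int>"
    unfolding eventually_sequentially by auto
  \<comment> \<open>From index 2N on the denominators are at least 2^N \<ge> N, so the bound from
    the liminf applies to them.\<close>
  define M where "M = 2 * N"
  have "c > 0" using c c' by simp
  define L where "L = max 0 (ln (1 / c))"
  let ?q = "\<lambda>n. real_of_int (cf_denom \<alpha> n)"
  have q: "?q n > 0" for n using cf_denom_pos[OF irr] by simp
  have q1: "?q n \<ge> 1" for n using cf_denom_pos[OF irr, of n] by linarith
  have step: "ln (?q (Suc n)) \<le> ln (?q n) + L" if "n \<ge> M" for n
  proof -
    have "int N \<le> 2 ^ N" by (metis less_exp less_imp_le of_nat_le_iff of_nat_numeral of_nat_power)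
    also have "\<dots> \<le> cf_denom \<alpha> (0 + 2 * N)" using cf_denom_add[of N 0] by simp
    also have "\<dots> \<le> cf_denom \<alpha> n" using that by (intro mono_cf_denom) (simp add: M_def)
    finally have "N \<le> nat (cf_denom \<alpha> n)" by simp
    from N[OF this] have "c < ?q n * infdist (?q n * \<alpha>) \<int>" using cf_denom_pos[OF irr, of n] by simp
    also have "\<dots> \<le> ?q n * \<bar>cf_err \<alpha> n\<bar>"
      using infdist_le[of "of_int (cf_num \<alpha> n)" "\<int>" "?q n * \<alpha>"] q[of n]
      by (intro mult_left_mono) (auto simp: cf_err_def dist_real_def)
    finally have "c < ?q n * \<bar>cf_err \<alpha> n\<bar>" .
    then have "?q (Suc n) * c \<le> ?q n * (?q (Suc n) * \<bar>cf_err \<alpha> n\<bar>)"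
      using mult_left_mono[of c "?q n * \<bar>cf_err \<alpha> n\<bar>" "?q (Suc n)"] q[of "Suc n"] by (simp add: algebra_simps)
    also have "\<dots> \<le> ?q n * 1"
    proof (intro mult_left_mono)
      have "0 \<le> ?q n * \<bar>cf_err \<alpha> (Suc n)\<bar>" using q[of n] by simp
      then show "?q (Suc n) * \<bar>cf_err \<alpha> n\<bar> \<le> 1" using cf_err_det[of n] by linarith
    qed (use q[of n] in simp)
    finally have "?q (Suc n) \<le> ?q n * (1 / c)" using \<open>c > 0\<close> by (simp add: field_simps)
    then have "ln (?q (Suc n)) \<le> ln (?q n * (1 / c))" by (rule ln_mono) (rule q)
    also have "\<dots> = ln (?q n) + ln (1 / c)" using q[of n] \<open>c > 0\<close> by (simp add: ln_div)
    finally show ?thesis by (simp add: L_def)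
  qed
  have above: "ln (?q (M + k)) \<le> ln (?q M) + L * real k" for k
  proof (induction k)
    case (Suc k)
    then show ?case using step[of "M + k"] by (simp add: algebra_simps)
  qed simp
  have L: "L \<ge> 0" by (simp add: L_def)
  have lnM: "ln (?q M) \<ge> 0" using q1 by simp
  have "ln (?q n) \<le> (ln (?q M) + L) * real n" for n
  proof (cases "n = 0")
    case False
    have "ln (?q n) \<le> ln (?q M) + L * real n"
    proof (cases "n \<le> M")
      case True
      then have "ln (?q n) \<le> ln (?q M)" using mono_cf_denom[OF True] q by simp
      then show ?thesis using L by (simp add: add_increasing2)
    next
      case False
      then have "ln (?q n) \<le> ln (?q M) + L * real (n - M)" using above[of "n - M"] by simp
      also have "\<dots> \<le> ln (?q M) + L * real n" using L by (intro add_left_mono mult_left_mono) auto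
      finally show ?thesis .
    qed
    also have "\<dots> \<le> ln (?q M) * real n + L * real n"
      using False lnM mult_left_mono[of 1 "real n" "ln (?q M)"] by simp
    finally show ?thesis by (simp add: algebra_simps)
  qed simp
  then show ?thesis using L lnM by (intro exI[of _ "ln (?q M) + L"]) auto
qed

end

section \<open>Measure estimates\<close>

lemma sum_lessThan_add:
  fixes f :: "nat \<Rightarrow> 'a::comm_monoid_add"
  shows "(\<Sum>j<a + b. f j) = (\<Sum>j<a. f j) + (\<Sum>j<b. f (a + j))"
  by (induction b) (simp_all add: add.assoc)

lemma harmonic_sum_le: "n \<ge> 1 \<Longrightarrow> (\<Sum>i=1..n. 1 / real i) \<le> 1 + ln (real n)"
proof (induction n rule: nat_induct_at_least)
  case (Suc n)
  have "ln (real n / real (Suc n)) \<le> real n / real (Suc n) - 1"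
    using Suc.hyps by (intro ln_le_minus_one) simp
  moreover have "real n / real (Suc n) - 1 = - (1 / real (Suc n))" by (simp add: field_simps)
  moreover have "ln (real n / real (Suc n)) = ln (real n) - ln (real (Suc n))"
    using Suc.hyps by (simp add: ln_div)
  ultimately have "1 / real (Suc n) \<le> ln (real (Suc n)) - ln (real n)" by linarith
  then show ?case using Suc by simp
qed simp

lemma summable_poly_geometric: "summable (\<lambda>n. (real n + 1)\<^sup>2 * (1 / 2) ^ n)"
proof (rule summable_comparison_test_bigo)
  show "summable (\<lambda>n. norm (1 / real (n + 1) ^ 2))"
    using summable_ignore_initial_segment[OF inverse_power_summable[of 2, where ?'a = real], of 1]
    by (simp add: inverse_eq_divide)
  show "(\<lambda>n. (real n + 1)\<^sup>2 * (1 / 2) ^ n) \<in> O(\<lambda>n. 1 / real (n + 1) ^ 2)"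
    by real_asymp
qed

lemma Suc_le_5_10: "i + 2 \<le> 5 * 10 ^ i"
  by (induction i) auto

text \<open>The functions \<open>b\<close> and \<open>R\<close> are indexed from 0: \<open>b k\<close> is the paper's \<open>b\<close> with index \<open>k + 1\<close>, and
  \<open>R k\<close> its \<open>c\<close> with index \<open>k + 1\<close>.\<close>
locale veech_skew =
  fixes \<alpha> :: real
  assumes irr: "\<alpha> \<notin> \<rat>" and range: "\<alpha> \<in> {0<..<1/3}" and ba: "badly_approximable \<alpha>"
begin

definition b :: "nat \<Rightarrow> nat" where "b k = nat (b_seq \<alpha> (Suc k))"
text \<open>Chosen so that \<open>m k * \<alpha>\<close> is congruent to \<open>s_part k\<close>
  modulo 1.\<close>

definition m :: "nat \<Rightarrow> nat" where "m k = (\<Sum>i<k. nat (c_seq \<alpha> (Suc i)))"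
definition n :: "nat \<Rightarrow> nat" where "n k = 1 + (\<Sum>i<k. b i)"
definition R :: "nat \<Rightarrow> nat" where "R k = nat (cf_denom \<alpha> (10 ^ Suc k))"
text \<open>\<open>s\<close> and \<open>Y\<close> omit the outer \<open>frac\<close> of
  \<open>arc_J\<close> and \<open>y_inf\<close>; both turn out to lie in [0, 1).\<close>

definition s :: real where "s = (\<Sum>i. frac (of_int (c_seq \<alpha> (Suc i)) * \<alpha>))"
definition s_part :: "nat \<Rightarrow> real" where "s_part k = (\<Sum>i<k. frac (of_int (c_seq \<alpha> (Suc i)) * \<alpha>))"
definition Y :: real where "Y = \<alpha> + (\<Sum>i. frac (of_int (b_seq \<alpha> (Suc i)) * \<alpha>))"

section \<open>Lengths and positions of the two arcs\<close>

lemma \<alpha>: "0 < \<alpha>" "\<alpha> < 1/3" using range by auto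

lemma real_b: "real (b k) = of_int (cf_denom \<alpha> (2 * 10 ^ Suc k))"
  using cf_denom_pos[OF irr, of "2 * 10 ^ Suc k"] by (simp add: b_def b_seq_def)

lemma real_c: "real (nat (c_seq \<alpha> i)) = of_int (c_seq \<alpha> i)"
  using cf_denom_pos[OF irr, of "10 ^ i"] by (simp add: c_seq_def)

lemma real_R: "real (R k) = of_int (cf_denom \<alpha> (10 ^ Suc k))"
  using cf_denom_pos[OF irr, of "10 ^ Suc k"] by (simp add: R_def)

lemma frac_c: "frac (of_int (c_seq \<alpha> (Suc i)) * \<alpha>) = cf_err \<alpha> (10 ^ Suc i)"
  unfolding c_seq_def using \<alpha> by (intro frac_cf_denom irr) auto

lemma frac_b: "frac (of_int (b_seq \<alpha> (Suc i)) * \<alpha>) = cf_err \<alpha> (2 * 10 ^ Suc i)"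
  unfolding b_seq_def using \<alpha> by (intro frac_cf_denom irr) auto

lemma err_c_pos: "cf_err \<alpha> (10 ^ Suc i) > 0" by (intro cf_err_even_pos irr) simp
lemma err_b_pos: "cf_err \<alpha> (2 * 10 ^ Suc i) > 0" by (intro cf_err_even_pos irr) simp

text \<open>The errors start at \<alpha> and halve every two indices. The offset 2 yields the factor
  1/4, so both series sum to at most \<alpha>/2; this later keeps J and J' disjoint inside [0,
  1).\<close>

lemma err_le:
  assumes "i + 2 \<le> k"
  shows "cf_err \<alpha> (2 * k) \<le> \<alpha> / 4 * (1/2) ^ i"
proof -
  have "cf_err \<alpha> 0 = \<alpha>" using \<alpha> floor_eq_iff[of \<alpha> 0] by (simp add: cf_err_def cf_quotient_def)
  then have "cf_err \<alpha> (2 * k) \<le> \<alpha> / 2 ^ k"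
    using abs_cf_err_add[OF irr, of 0 k] \<alpha> by simp
  also have "\<dots> \<le> \<alpha> / 2 ^ (i + 2)" using assms \<alpha> by (intro divide_left_mono power_increasing) auto
  also have "\<dots> = \<alpha> / 4 * (1/2) ^ i" by (simp add: power_divide power_add)
  finally show ?thesis .
qed

lemma err_c_le: "cf_err \<alpha> (10 ^ Suc i) \<le> \<alpha> / 4 * (1/2) ^ i"
  using err_le[OF Suc_le_5_10[of i]] by simp

lemma err_b_le: "cf_err \<alpha> (2 * 10 ^ Suc i) \<le> \<alpha> / 4 * (1/2) ^ i"
  using Suc_le_5_10[of i] by (intro err_le) simp

lemma geom_sums: "(\<lambda>i. \<alpha> / 4 * (1/2) ^ i) sums (\<alpha> / 2)"
  using sums_mult[OF geometric_sums[of "1/2::real"], of "\<alpha> / 4"] by simp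

lemma summable_err_c: "summable (\<lambda>i. cf_err \<alpha> (10 ^ Suc i))"
  by (rule summable_comparison_test'[OF sums_summable[OF geom_sums], of 0])
     (use err_c_le err_c_pos in \<open>simp add: less_imp_le abs_of_pos del: power_Suc\<close>)

lemma summable_err_b: "summable (\<lambda>i. cf_err \<alpha> (2 * 10 ^ Suc i))"
  by (rule summable_comparison_test'[OF sums_summable[OF geom_sums], of 0])
     (use err_b_le err_b_pos in \<open>simp add: less_imp_le abs_of_pos del: power_Suc\<close>)

lemma s_eq: "s = (\<Sum>i. cf_err \<alpha> (10 ^ Suc i))" unfolding s_def frac_c ..
lemma s_part_eq: "s_part k = (\<Sum>i<k. cf_err \<alpha> (10 ^ Suc i))" unfolding s_part_def frac_c ..
lemma Y_eq: "Y = \<alpha> + (\<Sum>i. cf_err \<alpha> (2 * 10 ^ Suc i))" unfolding Y_def frac_b ..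

lemma s_bounds: "0 < s" "s \<le> \<alpha> / 2"
proof -
  show "0 < s" unfolding s_eq by (rule suminf_pos[OF summable_err_c err_c_pos])
  show "s \<le> \<alpha> / 2" unfolding s_eq sums_unique[OF geom_sums]
    by (rule suminf_le[OF err_c_le summable_err_c sums_summable[OF geom_sums]])
qed

lemma Y_bounds: "\<alpha> \<le> Y" "Y \<le> \<alpha> + \<alpha> / 2"
proof -
  show "\<alpha> \<le> Y" unfolding Y_eq using suminf_nonneg[OF summable_err_b less_imp_le[OF err_b_pos]] by simp
  show "Y \<le> \<alpha> + \<alpha> / 2" unfolding Y_eq sums_unique[OF geom_sums]
    by (intro add_left_mono suminf_le[OF err_b_le summable_err_b sums_summable[OF geom_sums]])
qed

lemma s_part_bounds: "0 \<le> s_part k" "s_part k \<le> s"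
proof -
  show "0 \<le> s_part k" unfolding s_part_eq by (intro sum_nonneg less_imp_le[OF err_c_pos])
  show "s_part k \<le> s" unfolding s_eq s_part_eq
    by (rule sum_le_suminf[OF summable_err_c]) (simp_all add: less_imp_le[OF err_c_pos] del: power_Suc)
qed

text \<open>The indices grow so fast that the tail is dominated by a geometric series of ratio
  1/2.\<close>

lemma s_tail: "s - s_part k \<le> 2 * cf_err \<alpha> (10 ^ Suc k)"
proof -
  let ?e = "\<lambda>i. cf_err \<alpha> (10 ^ Suc i)"
  have "s - s_part k = (\<Sum>i. ?e (i + k))"
    unfolding s_eq s_part_eq using suminf_split_initial_segment[OF summable_err_c, of k] by simp
  also have "\<dots> \<le> (\<Sum>i. ?e k * (1/2) ^ i)"
  proof (rule suminf_le)
    show "?e (i + k) \<le> ?e k * (1/2) ^ i" for i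
    proof -
      \<comment> \<open>Half the gap between the indices 10^(k+1) and 10^(i+k+1).\<close>
      define d :: nat where "d = 5 * 10 ^ k * (10 ^ i - 1)"
      have "i < 10 ^ i" by (rule less_exp[THEN less_le_trans]) (rule power_mono; simp)
      then have "1 * i \<le> 5 * 10 ^ k * (10 ^ i - 1)" by (intro mult_le_mono) auto
      then have d: "i \<le> d" by (simp add: d_def)
      have "10 ^ Suc (i + k) = 10 ^ Suc k + 2 * d"
        by (simp add: d_def power_add algebra_simps)
      then have "?e (i + k) \<le> ?e k / 2 ^ d"
        using abs_cf_err_add[OF irr, of "10 ^ Suc k" d] err_c_pos[of k] err_c_pos[of "i + k"] by (simp del: power_Suc)
      also have "\<dots> \<le> ?e k / 2 ^ i" using d err_c_pos[of k] by (intro divide_left_mono power_increasing) auto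
      finally show ?thesis by (simp add: power_divide)
    qed
    show "summable (\<lambda>i. ?e (i + k))" by (rule summable_ignore_initial_segment[OF summable_err_c])
    show "summable (\<lambda>i. ?e k * (1/2) ^ i)" by (intro summable_mult summable_geometric) simp
  qed
  also have "\<dots> = ?e k * (\<Sum>i. (1/2) ^ i)" by (rule suminf_mult) (intro summable_geometric, simp)
  also have "\<dots> = 2 * ?e k" by (subst suminf_geometric) auto
  finally show ?thesis .
qed

text \<open>Bounds the measure of the exceptional set \<open>D k\<close> within [0, 1), one summand
  for each of its two families of arcs.\<close>

definition err_meas :: "nat \<Rightarrow> real" where
  "err_meas k = real (b k) * (s - s_part (Suc k)) + real (m (Suc k)) * cf_err \<alpha> (2 * 10 ^ Suc k)"

lemma err_meas_nonneg: "0 \<le> err_meas k"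
  using s_part_bounds[of "Suc k"] err_b_pos[of k] by (simp add: err_meas_def)

section \<open>Summability of the measures of the exceptional sets\<close>

lemma m_le: "real (m (Suc k)) \<le> real (Suc k) * of_int (cf_denom \<alpha> (10 ^ Suc k))"
proof -
  have "real (m (Suc k)) = (\<Sum>i<Suc k. of_int (cf_denom \<alpha> (10 ^ Suc i)))"
    unfolding m_def of_nat_sum real_c by (simp add: c_seq_def)
  also have "\<dots> \<le> (\<Sum>i<Suc k. of_int (cf_denom \<alpha> (10 ^ Suc k)))"
    by (intro sum_mono of_int_le_iff[THEN iffD2] mono_cf_denom irr power_increasing) auto
  finally show ?thesis by simp
qed

lemma n_le: "real (n k) \<le> real (Suc k) * of_int (cf_denom \<alpha> (2 * 10 ^ k))"
proof -
  have "real (n k) = of_int (cf_denom \<alpha> 0) + (\<Sum>i<k. of_int (cf_denom \<alpha> (2 * 10 ^ Suc i)))"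
    by (simp add: n_def real_b)
  also have "\<dots> \<le> of_int (cf_denom \<alpha> (2 * 10 ^ k)) + (\<Sum>i<k. of_int (cf_denom \<alpha> (2 * 10 ^ k)))"
    by (intro add_mono sum_mono of_int_le_iff[THEN iffD2] mono_cf_denom irr mult_left_mono power_increasing) auto
  finally show ?thesis by (simp add: algebra_simps)
qed

lemma Suc_le_10: "Suc k \<le> 10 ^ k" by (induction k) auto

lemma err_meas_le: "err_meas k \<le> (real (5 * 10 ^ k) + 2) * (1/2) ^ (5 * 10 ^ k)"
proof -
  \<comment> \<open>Half the gap between the indices 10^(k+1) and 2 * 10^(k+1); the next gap, up to
    10^(k+2), is 16 L.\<close>
  define L :: nat where "L = 5 * 10 ^ k"
  have e1: "(2 * 10 ^ Suc k :: nat) = 10 ^ Suc k + 2 * L" by (simp add: L_def)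
  have e2: "(10 ^ Suc (Suc k) :: nat) = 2 * 10 ^ Suc k + 2 * (8 * L)" by (simp add: L_def)
  have "real (b k) * (s - s_part (Suc k)) \<le> real (b k) * (2 * cf_err \<alpha> (10 ^ Suc (Suc k)))"
    using s_tail[of "Suc k"] by (intro mult_left_mono) auto
  also have "\<dots> = 2 * (of_int (cf_denom \<alpha> (2 * 10 ^ Suc k)) * \<bar>cf_err \<alpha> (2 * 10 ^ Suc k + 2 * (8 * L))\<bar>)"
    unfolding e2[symmetric] real_b using err_c_pos[of "Suc k"] by (simp del: power_Suc)
  also have "\<dots> \<le> 2 * (1 / 2 ^ (8 * L))" by (intro mult_left_mono cf_denom_err_add irr) auto
  also have "\<dots> \<le> 2 * (1 / 2 ^ L)" by (intro mult_left_mono divide_left_mono power_increasing) auto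
  finally have 1: "real (b k) * (s - s_part (Suc k)) \<le> 2 * (1/2) ^ L" by (simp add: power_divide)
  have "real (m (Suc k)) * cf_err \<alpha> (2 * 10 ^ Suc k)
      \<le> real (Suc k) * of_int (cf_denom \<alpha> (10 ^ Suc k)) * cf_err \<alpha> (2 * 10 ^ Suc k)"
    using m_le err_b_pos[of k] by (intro mult_right_mono) auto
  also have "\<dots> = real (Suc k) * (of_int (cf_denom \<alpha> (10 ^ Suc k)) * \<bar>cf_err \<alpha> (10 ^ Suc k + 2 * L)\<bar>)"
    unfolding e1[symmetric] using err_b_pos[of k] by (simp del: power_Suc)
  also have "\<dots> \<le> real (Suc k) * (1 / 2 ^ L)" by (intro mult_left_mono cf_denom_err_add irr) auto
  also have "\<dots> \<le> real L * (1 / 2 ^ L)" using Suc_le_10[of k]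
    by (intro mult_right_mono of_nat_mono) (auto simp: L_def)
  finally have 2: "real (m (Suc k)) * cf_err \<alpha> (2 * 10 ^ Suc k) \<le> real L * (1/2) ^ L" by (simp add: power_divide)
  from 1 2 show ?thesis unfolding err_meas_def L_def[symmetric] by (simp add: algebra_simps)
qed

lemma R_ge_2: "R k \<ge> 2"
proof -
  have "2 * cf_denom \<alpha> 0 \<le> cf_denom \<alpha> (Suc (Suc 0))" by (rule cf_denom_Suc_Suc[OF irr])
  also have "\<dots> \<le> cf_denom \<alpha> (10 ^ Suc k)" by (intro mono_cf_denom irr) (use Suc_le_10[of k] in simp)
  finally have "2 \<le> cf_denom \<alpha> (10 ^ Suc k)" by simp
  then show ?thesis by (simp add: R_def)
qed

lemma R_mono: "i \<le> k \<Longrightarrow> R i \<le> R k"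
  unfolding R_def by (intro nat_mono mono_cf_denom irr power_increasing) auto

lemma R_gt: "k < R k"
proof -
  have "int k < 2 ^ k" using of_nat_less_two_power by simp
  also have "\<dots> \<le> 2 ^ k * cf_denom \<alpha> 0" by simp
  also have "\<dots> \<le> cf_denom \<alpha> (0 + 2 * k)" by (rule cf_denom_add[OF irr])
  also have "\<dots> \<le> cf_denom \<alpha> (10 ^ Suc k)" using Suc_le_10[of k] by (intro mono_cf_denom irr) simp
  finally show ?thesis by (simp add: R_def)
qed

text \<open>Bounds the sets \<open>G k\<close>: each of \<open>n k\<close> orbit points contributes
  two balls of radius \<open>1 / R k\<close>. Between the indices 2 * 10^k and 10^(k+1) the
  denominators gain a factor 2^(4 * 10^k).\<close>

lemma summable_disc: "summable (\<lambda>k. real (n k) * (4 / real (R k)))"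
proof (rule summable_comparison_test'[OF summable_mult[OF summable_poly_geometric, of 4], of 0])
  fix k
  have e: "(10 ^ Suc k :: nat) = 2 * 10 ^ k + 2 * (4 * 10 ^ k)" by simp
  let ?q = "real_of_int (cf_denom \<alpha> (2 * 10 ^ k))"
  have q: "?q > 0" using cf_denom_pos[OF irr] by simp
  have "real_of_int (2 ^ (4 * 10 ^ k) * cf_denom \<alpha> (2 * 10 ^ k)) \<le> of_int (cf_denom \<alpha> (10 ^ Suc k))"
    unfolding e by (intro of_int_le_iff[THEN iffD2] cf_denom_add irr)
  then have R: "2 ^ (4 * 10 ^ k) * ?q \<le> real (R k)" by (simp only: real_R of_int_mult of_int_power of_int_numeral)
  have "real (n k) * (4 / real (R k)) \<le> real (Suc k) * ?q * (4 / (2 ^ (4 * 10 ^ k) * ?q))"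
    using n_le[of k] R q R_ge_2[of k] by (intro mult_mono divide_left_mono) auto
  also have "\<dots> = 4 * (real (Suc k) * (1 / 2 ^ (4 * 10 ^ k)))" using q by (simp add: field_simps)
  also have "\<dots> \<le> 4 * (real (Suc k) * (1 / 2 ^ k))"
    using Suc_le_10[of k] by (intro mult_left_mono divide_left_mono power_increasing) auto
  also have "\<dots> \<le> 4 * ((real k + 1)\<^sup>2 * (1 / 2 ^ k))"
    by (intro mult_left_mono mult_right_mono) (auto simp: power2_eq_square algebra_simps)
  finally show "norm (real (n k) * (4 / real (R k))) \<le> 4 * ((real k + 1)\<^sup>2 * (1 / 2) ^ k)"
    by (simp add: power_divide)
qed

text \<open>Here bad approximability enters. The harmonic sum is logarithmic in
  \<open>R (Suc k)\<close>, hence at most linear in L = 5 * 10^k, while \<open>err_meas k\<close>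
  decays like L / 2^L.\<close>

lemma summable_hits: "summable (\<lambda>k. (\<Sum>i=1..R (Suc k). 2 / real i) * err_meas k)"
proof -
  obtain C where C: "C \<ge> 0" "\<And>n. ln (of_int (cf_denom \<alpha> n)) \<le> C * real n"
    using cf_denom_growth[OF irr ba] by auto
  define f where "f = (\<lambda>L. (4 + 80 * C) * ((real L + 1)\<^sup>2 * (1/2) ^ L))"
  have inj: "inj (\<lambda>k::nat. 5 * 10 ^ k :: nat)" by (auto simp: inj_on_def)
  have "summable f" unfolding f_def by (intro summable_mult summable_poly_geometric)
  then have "summable (f \<circ> (\<lambda>k. 5 * 10 ^ k))"
    using C by (intro summable_reindex inj) (auto simp: f_def)
  then show ?thesis
  proof (rule summable_comparison_test'[of _ 0])
    fix k
    define L :: nat where "L = 5 * 10 ^ k"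
    have "(\<Sum>i=1..R (Suc k). 1 / real i) \<le> 1 + ln (real (R (Suc k)))"
      using R_ge_2[of "Suc k"] by (intro harmonic_sum_le) simp
    also have "\<dots> \<le> 1 + C * real (20 * L)" using C(2)[of "10 ^ Suc (Suc k)"] by (simp add: real_R L_def del: cf_denom.simps)
    also have "\<dots> \<le> (1 + 20 * C) * (real L + 1)" using C(1) by (simp add: algebra_simps)
    finally have 1: "(\<Sum>i=1..R (Suc k). 2 / real i) \<le> 2 * ((1 + 20 * C) * (real L + 1))"
      using sum_distrib_left[of 2 "\<lambda>i. 1 / real i" "{1..R (Suc k)}"] by simp
    have "(\<Sum>i=1..R (Suc k). 2 / real i) * err_meas k
       \<le> 2 * ((1 + 20 * C) * (real L + 1)) * ((real L + 2) * (1/2) ^ L)"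
      using 1 err_meas_le[of k] err_meas_nonneg[of k] C(1) unfolding L_def[symmetric]
      by (intro mult_mono) auto
    also have "\<dots> \<le> 2 * ((1 + 20 * C) * (real L + 1)) * ((2 * (real L + 1)) * (1/2) ^ L)"
      using C(1) by (intro mult_left_mono mult_right_mono) auto
    also have "\<dots> = f L" by (simp add: f_def power2_eq_square algebra_simps)
    finally show "norm ((\<Sum>i=1..R (Suc k). 2 / real i) * err_meas k) \<le> (f \<circ> (\<lambda>k. 5 * 10 ^ k)) k"
      using err_meas_nonneg[of k] by (simp add: L_def sum_nonneg)
  qed
qed

lemma summable_err_meas: "summable err_meas"
proof (rule summable_comparison_test'[OF summable_hits, of 0])
  fix k
  have "2 / real 1 \<le> (\<Sum>i=1..R (Suc k). 2 / real i)"
    using R_ge_2[of "Suc k"] by (intro member_le_sum) auto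
  then have "1 * err_meas k \<le> (\<Sum>i=1..R (Suc k). 2 / real i) * err_meas k"
    using err_meas_nonneg[of k] by (intro mult_right_mono) auto
  then show "norm (err_meas k) \<le> (\<Sum>i=1..R (Suc k). 2 / real i) * err_meas k"
    using err_meas_nonneg[of k] by simp
qed
end

section \<open>The transfer function\<close>

lemma infdist_Ints_minus_commute: "infdist (x - y) \<int> = infdist (y - x) (\<int> :: real set)"
proof -
  have "infdist (x - y) \<int> < r \<longleftrightarrow> infdist (y - x) \<int> < r" for r
  proof -
    have "\<bar>x - y - of_int k\<bar> = \<bar>y - x - of_int (- k)\<bar>" for k by simp
    then show ?thesis unfolding infdist_Ints_less_iff by (metis minus_minus)
  qed
  then show ?thesis by (meson less_irrefl linorder_neqE)
qed

lemma emeasure_UN_le: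
  assumes "finite I" "\<And>i. i \<in> I \<Longrightarrow> A i \<in> sets M" "\<And>i. i \<in> I \<Longrightarrow> emeasure M (A i) \<le> ennreal (c i)"
    "\<And>i. i \<in> I \<Longrightarrow> 0 \<le> c i"
  shows "emeasure M (\<Union>i\<in>I. A i) \<le> ennreal (\<Sum>i\<in>I. c i)"
proof -
  have "emeasure M (\<Union>i\<in>I. A i) \<le> (\<Sum>i\<in>I. emeasure M (A i))"
    using assms by (intro emeasure_subadditive_finite) auto
  also have "\<dots> \<le> (\<Sum>i\<in>I. ennreal (c i))" using assms by (intro sum_mono) auto
  also have "\<dots> = ennreal (\<Sum>i\<in>I. c i)" using assms by (simp add: sum_ennreal)
  finally show ?thesis .
qed

lemma measurable_jump_set: "{x\<in>{0..<1}. jump \<beta> (x - z) \<noteq> 0} \<in> sets lborel"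
  by measurable

lemma borel_cantelli_bound:
  assumes "\<And>n. A n \<in> sets M" "\<And>n. emeasure M (A n) \<le> ennreal (f n)" "\<And>n. 0 \<le> f n" "summable f"
  shows "AE x in M. \<forall>\<^sub>F n in sequentially. x \<notin> A n"
proof -
  have fin: "emeasure M (A n) < \<infinity>" for n using assms(2)[of n] by (rule le_less_trans) simp
  have "measure M (A n) \<le> f n" for n
    using assms(2,3)[of n] unfolding measure_def by (simp add: enn2real_leI)
  then have "summable (\<lambda>n. measure M (A n))"
    by (intro summable_comparison_test'[OF assms(4), of 0]) simp
  from borel_cantelli_AE1[OF assms(1) fin this] show ?thesis
    by eventually_elim (auto elim: eventually_mono)
qed

context veech_skew
begin

text \<open>The first condition accounts for replacing \<open>s\<close> by \<open>s_part (Suc k) \<equiv> m (Suc k) * \<alpha>\<close>, the second one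
  for the jumps of the count of \<open>b k\<close> orbit points in the resulting arc.\<close>
definition D :: "nat \<Rightarrow> real set" where
  "D k = {x. (\<exists>j\<in>{..<b k}. jump (s - s_part (Suc k)) (x - (real (n k + 1 + j) * \<alpha> + s_part (Suc k))) \<noteq> 0) \<or>
    (\<exists>j\<in>{..<m (Suc k)}. jump (cf_err \<alpha> (2 * 10 ^ Suc k)) (x - real (n k + 1 + j) * \<alpha>) \<noteq> 0)}"

definition h :: "nat \<Rightarrow> real \<Rightarrow> int" where
  "h k x = (\<Sum>j<n k. jump s (x - real (j + 1) * \<alpha>))"

text \<open>The constant value of \<open>h (Suc k) - h k\<close> off \<open>D k\<close>.\<close>

definition e :: "nat \<Rightarrow> int" where
  "e k = int (m (Suc k)) * \<lfloor>real (b k) * \<alpha>\<rfloor> - int (b k) * \<lfloor>real (m (Suc k)) * \<alpha>\<rfloor>"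

definition g :: "nat \<Rightarrow> real \<Rightarrow> int" where
  "g k x = h k x - (\<Sum>i<k. e i)"

text \<open>The points within \<open>1 / R k\<close> of a discontinuity of \<open>h k\<close>.\<close>
definition G :: "nat \<Rightarrow> real set" where
  "G k = {y. \<exists>j\<in>{..<n k}. infdist (y - real (j + 1) * \<alpha>) \<int> < 1 / real (R k) \<or>
    infdist (y - (real (j + 1) * \<alpha> + s)) \<int> < 1 / real (R k)}"

section \<open>Measurability and size of the exceptional sets\<close>

lemma measurable_D [measurable]: "D k \<in> sets borel"
  unfolding D_def by measurable

lemma borel_measurable_infdist_Ints [measurable]: "(\<lambda>x. infdist x (\<int> :: real set)) \<in> borel_measurable borel"
  by (intro borel_measurable_continuous_onI continuous_on_infdist continuous_on_id)

lemma measurable_G [measurable]: "G k \<in> sets borel"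
  unfolding G_def by measurable

text \<open>The translation \<open>t\<close> only moves the starting points of the arcs, so the
  bound is uniform along orbits.\<close>

lemma emeasure_D_le: "emeasure lborel {x\<in>{0..<1}. x + t \<in> D k} \<le> ennreal (err_meas k)"
proof -
  let ?A = "\<lambda>j. {x\<in>{0..<1}. jump (s - s_part (Suc k)) (x - ((real (n k + 1 + j) * \<alpha> + s_part (Suc k)) - t)) \<noteq> 0}"
  let ?B = "\<lambda>j. {x\<in>{0..<1}. jump (cf_err \<alpha> (2 * 10 ^ Suc k)) (x - (real (n k + 1 + j) * \<alpha> - t)) \<noteq> 0}"
  have "{x\<in>{0..<1}. x + t \<in> D k} = (\<Union>j\<in>{..<b k}. ?A j) \<union> (\<Union>j\<in>{..<m (Suc k)}. ?B j)"
    by (auto simp: D_def algebra_simps)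
  then have "emeasure lborel {x\<in>{0..<1}. x + t \<in> D k}
      \<le> emeasure lborel (\<Union>j\<in>{..<b k}. ?A j) + emeasure lborel (\<Union>j\<in>{..<m (Suc k)}. ?B j)"
    by (simp only:) (rule emeasure_subadditive; measurable)
  also have "emeasure lborel (\<Union>j\<in>{..<b k}. ?A j) \<le> ennreal (\<Sum>j\<in>{..<b k}. s - s_part (Suc k))"
    using s_part_bounds[of "Suc k"] by (intro emeasure_UN_le emeasure_jump_le measurable_jump_set) simp_all
  also have "emeasure lborel (\<Union>j\<in>{..<m (Suc k)}. ?B j) \<le> ennreal (\<Sum>j\<in>{..<m (Suc k)}. cf_err \<alpha> (2 * 10 ^ Suc k))"
    using err_b_pos[of k] by (intro emeasure_UN_le emeasure_jump_le measurable_jump_set) (simp_all del: power_Suc)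
  finally show ?thesis
    using s_part_bounds[of "Suc k"] err_b_pos[of k]
    by (simp add: err_meas_def ennreal_plus[symmetric] add_mono del: ennreal_plus power_Suc)
qed

lemma emeasure_G_le: "emeasure lborel ({0..<1} \<inter> G k) \<le> ennreal (real (n k) * (4 / real (R k)))"
proof -
  let ?r = "1 / real (R k)"
  let ?A = "\<lambda>j. {y\<in>{0..<1}. infdist (y - real (j + 1) * \<alpha>) \<int> < ?r} \<union>
                {y\<in>{0..<1}. infdist (y - (real (j + 1) * \<alpha> + s)) \<int> < ?r}"
  have le: "emeasure lborel (?A j) \<le> ennreal (4 * ?r)" for j
  proof -
    have "emeasure lborel (?A j) \<le> emeasure lborel {y\<in>{0..<1}. infdist (y - real (j + 1) * \<alpha>) \<int> < ?r} +
        emeasure lborel {y\<in>{0..<1}. infdist (y - (real (j + 1) * \<alpha> + s)) \<int> < ?r}"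
      by (rule emeasure_subadditive) measurable
    also have "\<dots> \<le> ennreal (2 * ?r) + ennreal (2 * ?r)"
      by (intro add_mono emeasure_near_le) auto
    finally show ?thesis by (simp add: ennreal_plus[symmetric] del: ennreal_plus)
  qed
  have "{0..<1} \<inter> G k = (\<Union>j\<in>{..<n k}. ?A j)" by (auto simp: G_def)
  moreover have "emeasure lborel (\<Union>j\<in>{..<n k}. ?A j) \<le> ennreal (\<Sum>j\<in>{..<n k}. 4 * ?r)"
  proof (rule emeasure_UN_le)
    show "?A j \<in> sets lborel" for j by measurable
    show "emeasure lborel (?A j) \<le> ennreal (4 * ?r)" for j by (rule le)
  qed simp_all
  ultimately show ?thesis by simp
qed

lemma frac_m: "s_part k = real (m k) * \<alpha> - of_int \<lfloor>real (m k) * \<alpha>\<rfloor>"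
proof -
  have "real (m k) * \<alpha> - s_part k = (\<Sum>i<k. of_int \<lfloor>of_int (c_seq \<alpha> (Suc i)) * \<alpha>\<rfloor>)"
    unfolding m_def s_part_def of_nat_sum real_c sum_distrib_right sum_subtractf[symmetric]
    by (simp add: frac_def)
  then have "real (m k) * \<alpha> - s_part k \<in> \<int>" by (metis Ints_of_int of_int_sum)
  then have "frac (real (m k) * \<alpha>) = s_part k"
    using s_part_bounds[of k] s_bounds \<alpha> by (intro frac_unique_iff[THEN iffD2]) auto
  then show ?thesis by (simp add: frac_def)
qed

text \<open>Off \<open>D k\<close> the arc length \<open>s\<close> may be replaced by
  \<open>s_part (Suc k)\<close>, which is an orbit shift modulo 1, so each new count is a difference
  \<open>F j - F (j + M) - P\<close>. After the exchange every term is
  \<open>F j - F (j + b k)\<close>, equal to the constant \<open>Q\<close> because the short arcs of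
  error length are missed.\<close>

lemma g_Suc:
  assumes "x \<notin> D k"
  shows "g (Suc k) x = g k x"
proof -
  \<comment> \<open>\<open>F\<close> runs along the backward orbit, starting at the first point not
    counted by \<open>h k\<close>.\<close>
  define F where "F j = \<lfloor>x - real (n k + 1 + j) * \<alpha>\<rfloor>" for j
  define M where "M = m (Suc k)"
  define P where "P = \<lfloor>real M * \<alpha>\<rfloor>"
  define Q where "Q = \<lfloor>real (b k) * \<alpha>\<rfloor>"
  have sp: "s_part (Suc k) = real M * \<alpha> - of_int P" unfolding M_def P_def by (rule frac_m)
  have bk: "cf_err \<alpha> (2 * 10 ^ Suc k) = real (b k) * \<alpha> - of_int Q"
    using frac_b[of k] cf_denom_pos[OF irr, of "2 * 10 ^ Suc k"] by (simp add: frac_def Q_def b_def b_seq_def)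
  have 1: "jump s (x - real (n k + j + 1) * \<alpha>) = F j - F (j + M) - P" if "j < b k" for j
  proof -
    let ?u = "x - real (n k + 1 + j) * \<alpha>"
    have "jump (s - s_part (Suc k)) (?u - s_part (Suc k)) = 0"
      using assms that by (simp add: D_def diff_diff_eq)
    moreover have "?u - s_part (Suc k) - (s - s_part (Suc k)) = ?u - s" by simp
    ultimately have "\<lfloor>?u - s\<rfloor> = \<lfloor>?u - s_part (Suc k)\<rfloor>" by (simp only: jump_def)
    also have "?u - s_part (Suc k) = x - real (n k + 1 + (j + M)) * \<alpha> + of_int P"
      unfolding sp by (simp add: algebra_simps)
    finally have "\<lfloor>?u - s\<rfloor> = F (j + M) + P" by (simp add: F_def)
    then show ?thesis by (simp add: jump_def F_def add_ac)
  qed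
  have 2: "F j - F (j + b k) = Q" if "j < M" for j
  proof -
    let ?u = "x - real (n k + 1 + j) * \<alpha>"
    have "jump (cf_err \<alpha> (2 * 10 ^ Suc k)) ?u = 0"
      using assms that by (auto simp: D_def M_def simp del: power_Suc)
    then have "\<lfloor>?u\<rfloor> = \<lfloor>?u - cf_err \<alpha> (2 * 10 ^ Suc k)\<rfloor>" by (simp add: jump_def)
    also have "?u - cf_err \<alpha> (2 * 10 ^ Suc k) = x - real (n k + 1 + (j + b k)) * \<alpha> + of_int Q"
      unfolding bk by (simp add: algebra_simps)
    finally show ?thesis by (simp add: F_def)
  qed
  have "h (Suc k) x = h k x + (\<Sum>j<b k. jump s (x - real (n k + j + 1) * \<alpha>))"
  proof -
    have "n (Suc k) = n k + b k" by (simp add: n_def)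
    then show ?thesis unfolding h_def by (simp only: sum_lessThan_add)
  qed
  also have "(\<Sum>j<b k. jump s (x - real (n k + j + 1) * \<alpha>)) = (\<Sum>j<b k. F j - F (j + M)) - int (b k) * P"
    using sum.cong[OF refl 1, of "{..<b k}"] by (simp add: sum_subtractf)
  also have "(\<Sum>j<b k. F j - F (j + M)) = (\<Sum>j<M. F j - F (j + b k))" by (rule sum_shift_exchange)
  also have "\<dots> = int M * Q" by (simp add: 2)
  finally show ?thesis by (simp add: g_def e_def M_def P_def Q_def)
qed

text \<open>Off \<open>G k\<close> no integer translate of an endpoint of the counted arcs comes
  within \<open>1 / R k\<close> of y.\<close>

lemma g_eq_if_near:
  assumes "infdist (z - y) \<int> < 1 / real (R k)" "y \<notin> G k"
  shows "g k z = g k y"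
proof -
  have "jump s (z - real (j + 1) * \<alpha>) = jump s (y - real (j + 1) * \<alpha>)" if "j < n k" for j
    by (rule jump_eq_if_far[of _ _ "1 / real (R k)"]) (use assms that in \<open>auto simp: G_def algebra_simps\<close>)
  then show ?thesis by (simp add: g_def h_def)
qed

lemma g_coboundary: "g k (x + \<alpha>) - g k x = jump s x - jump s (x - real (n k) * \<alpha>)"
proof -
  have "(\<Sum>j<N. jump s (x + \<alpha> - real (j + 1) * \<alpha>)) - (\<Sum>j<N. jump s (x - real (j + 1) * \<alpha>))
      = jump s x - jump s (x - real N * \<alpha>)" for N
    by (induction N) (simp_all add: algebra_simps)
  from this[of "n k"] show ?thesis by (simp add: g_def h_def)
qed

text \<open>Modulo integers \<open>n k * \<alpha>\<close> converges to \<open>Y\<close>, and the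
  floors involved are locally constant away from the arc's endpoints.\<close>

lemma eventually_jump_n:
  assumes "z - Y \<notin> \<int>" "z - Y - s \<notin> \<int>"
  shows "\<forall>\<^sub>F k in sequentially. jump s (z - real (n k) * \<alpha>) = jump s (z - Y)"
proof -
  let ?y = "\<lambda>k. \<alpha> + (\<Sum>i<k. frac (of_int (b_seq \<alpha> (Suc i)) * \<alpha>))"
  have lim: "?y \<longlonglongrightarrow> Y"
    unfolding Y_def frac_b by (intro tendsto_add tendsto_const summable_LIMSEQ summable_err_b)
  have "\<forall>\<^sub>F k in sequentially. \<lfloor>z - ?y k\<rfloor> = \<lfloor>z - Y\<rfloor>"
    by (intro eventually_floor_eq tendsto_diff tendsto_const lim assms)
  moreover have "\<forall>\<^sub>F k in sequentially. \<lfloor>z - ?y k - s\<rfloor> = \<lfloor>z - Y - s\<rfloor>"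
    by (intro eventually_floor_eq tendsto_diff tendsto_const lim assms)
  ultimately show ?thesis
  proof eventually_elim
    case (elim k)
    define N where "N = (\<Sum>i<k. \<lfloor>of_int (b_seq \<alpha> (Suc i)) * \<alpha>\<rfloor>)"
    have "real (b i) = of_int (b_seq \<alpha> (Suc i))" for i unfolding real_b b_seq_def ..
    then have "real (n k) * \<alpha> = \<alpha> + (\<Sum>i<k. of_int (b_seq \<alpha> (Suc i)) * \<alpha>)"
      by (simp add: n_def algebra_simps sum_distrib_left)
    also have "\<dots> = ?y k + of_int N"
      by (simp add: N_def sum.distrib[symmetric] frac_def sum_subtractf)
    finally have "z - real (n k) * \<alpha> = z - ?y k + of_int (- N)" by simp
    then have "jump s (z - real (n k) * \<alpha>) = jump s (z - ?y k)" by (simp only: jump_add_int)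
    then show ?case using elim by (simp add: jump_def)
  qed
qed

text \<open>The eventual value of the integers \<open>g k x\<close>, meaningful only where they
  stabilize.\<close>

definition H :: "real \<Rightarrow> int" where
  "H x = (THE v. \<forall>\<^sub>F k in sequentially. g k x = v)"

lemma H_eq:
  assumes "\<forall>\<^sub>F k in sequentially. g k x = v"
  shows "H x = v"
  unfolding H_def
proof (rule the_equality)
  fix w assume "\<forall>\<^sub>F k in sequentially. g k x = w"
  from eventually_conj[OF assms this] show "w = v"
    by (metis (mono_tags, lifting) eventually_happens' trivial_limit_sequentially)
qed (rule assms)

text \<open>The equality holds already at index k, not merely in the limit; visits at a finite time
  need this.\<close>

lemma g_eq_H:
  assumes "\<And>l. l \<ge> k \<Longrightarrow> x \<notin> D l"
  shows "g k x = H x"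
proof -
  have "g l x = g k x" if "l \<ge> k" for l
    using that by (induction l rule: dec_induct) (simp_all add: g_Suc assms)
  then have "\<forall>\<^sub>F l in sequentially. g l x = g k x" unfolding eventually_sequentially by blast
  then show ?thesis by (simp add: H_eq)
qed

lemma eventually_g_eq_H:
  assumes "\<forall>\<^sub>F l in sequentially. x \<notin> D l"
  shows "\<forall>\<^sub>F k in sequentially. g k x = H x"
  using eventually_all_ge_at_top[OF assms] by (rule eventually_mono) (auto intro: g_eq_H)

lemma H_coboundary:
  assumes "\<forall>\<^sub>F l in sequentially. x \<notin> D l" "\<forall>\<^sub>F l in sequentially. x + \<alpha> \<notin> D l"
    "x - Y \<notin> \<int>" "x - Y - s \<notin> \<int>"
  shows "H (x + \<alpha>) - H x = jump s x - jump s (x - Y)"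
proof -
  have "\<forall>\<^sub>F k in sequentially. H (x + \<alpha>) - H x = jump s x - jump s (x - Y)"
    using eventually_g_eq_H[OF assms(1)] eventually_g_eq_H[OF assms(2)] eventually_jump_n[OF assms(3,4)]
  proof eventually_elim
    case (elim k)
    then show ?case using g_coboundary[of k x] by simp
  qed
  then show ?thesis by simp
qed

definition regular :: "real \<Rightarrow> bool" where
  "regular x \<longleftrightarrow> (\<forall>i. (\<forall>\<^sub>F l in sequentially. x + real i * \<alpha> \<notin> D l) \<and>
    x + real i * \<alpha> - Y \<notin> \<int> \<and> x + real i * \<alpha> - Y - s \<notin> \<int>)"

lemma H_iterate:
  assumes "regular x"
  shows "(\<Sum>j<i. jump s (x + real j * \<alpha>) - jump s (x + real j * \<alpha> - Y)) = H (x + real i * \<alpha>) - H x"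
proof (induction i)
  case (Suc i)
  have "x + real (Suc i) * \<alpha> = x + real i * \<alpha> + \<alpha>" by (simp add: algebra_simps)
  moreover have "H (x + real i * \<alpha> + \<alpha>) - H (x + real i * \<alpha>) = jump s (x + real i * \<alpha>) - jump s (x + real i * \<alpha> - Y)"
    using assms calculation[symmetric] unfolding regular_def by (intro H_coboundary) metis+
  ultimately show ?case using Suc by (simp only: sum.lessThan_Suc)
qed simp

section \<open>Borel-Cantelli statements for almost all points\<close>

lemma AE_D: "AE x in lborel. x \<in> {0..<1} \<longrightarrow> (\<forall>\<^sub>F l in sequentially. x + t \<notin> D l)"
proof -
  have "AE x in lborel. \<forall>\<^sub>F l in sequentially. x \<notin> {x\<in>{0..<1}. x + t \<in> D l}"
    by (rule borel_cantelli_bound[OF _ emeasure_D_le err_meas_nonneg summable_err_meas]) measurable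
  then show ?thesis by eventually_elim (auto elim: eventually_mono)
qed

lemma AE_G: "AE y in lborel. y \<in> {0..<1} \<longrightarrow> (\<forall>\<^sub>F k in sequentially. y \<notin> G k)"
proof -
  have "AE y in lborel. \<forall>\<^sub>F k in sequentially. y \<notin> {0..<1} \<inter> G k"
    by (rule borel_cantelli_bound[OF _ emeasure_G_le _ summable_disc]) (simp_all add: sets.Int)
  then show ?thesis by eventually_elim (auto elim: eventually_mono)
qed

lemma AE_regular: "AE x in lborel. x \<in> {0..<1} \<longrightarrow> regular x"
proof -
  have "AE x in lborel. x \<notin> (\<Union>i. (\<lambda>k. of_int k + Y - real i * \<alpha>) ` UNIV \<union> (\<lambda>k. of_int k + Y + s - real i * \<alpha>) ` UNIV)"
    by (intro AE_not_in countable_imp_null_set_lborel countable_UN countable_Un countable_image) auto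
  moreover have "AE x in lborel. \<forall>i. x \<in> {0..<1} \<longrightarrow> (\<forall>\<^sub>F l in sequentially. x + real i * \<alpha> \<notin> D l)"
    unfolding AE_all_countable by (intro allI AE_D)
  ultimately show ?thesis
  proof eventually_elim
    case (elim x)
    have "x + real i * \<alpha> - Y \<notin> \<int>" "x + real i * \<alpha> - Y - s \<notin> \<int>" for i
    proof -
      show "x + real i * \<alpha> - Y \<notin> \<int>"
      proof
        assume "x + real i * \<alpha> - Y \<in> \<int>"
        then obtain k where "x + real i * \<alpha> - Y = of_int k" by (auto elim: Ints_cases)
        then have "x = of_int k + Y - real i * \<alpha>" by simp
        then show False using elim by blast
      qed
      show "x + real i * \<alpha> - Y - s \<notin> \<int>"
      proof
        assume "x + real i * \<alpha> - Y - s \<in> \<int>"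
        then obtain k where "x + real i * \<alpha> - Y - s = of_int k" by (auto elim: Ints_cases)
        then have "x = of_int k + Y + s - real i * \<alpha>" by simp
        then show False using elim by blast
      qed
    qed
    then show ?case using elim by (auto simp: regular_def)
  qed
qed

text \<open>A visit \<open>i\<close> in the window \<open>{R k..<R (Suc k)}\<close> only needs \<open>x + i * \<alpha> \<notin> D l\<close> for \<open>l \<ge> k\<close>, that is, for
  those \<open>l\<close> with \<open>i < R (Suc l)\<close>.\<close>
definition A :: "nat \<Rightarrow> (real \<times> real) set" where
  "A l = {(y, x). y \<in> {0..<1} \<and> x \<in> {0..<1} \<and>
    (\<exists>i\<in>{1..R (Suc l)}. infdist (y - (x + real i * \<alpha>)) \<int> < 1 / real i \<and> x + real i * \<alpha> \<in> D l)}"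

text \<open>By Fubini with x fixed first: y lies in a ball of measure at most 2/i, and the points x
  with \<open>x + i * \<alpha>\<close> in \<open>D l\<close> have measure at most
  \<open>err_meas l\<close>.\<close>

lemma emeasure_A_le:
  "A l \<in> sets (lborel \<Otimes>\<^sub>M lborel)"
  "emeasure (lborel \<Otimes>\<^sub>M lborel) (A l) \<le> ennreal ((\<Sum>i=1..R (Suc l). 2 / real i) * err_meas l)"
proof -
  let ?B = "\<lambda>i. {p. fst p \<in> {0..<1} \<and> snd p \<in> {0..<1} \<and>
     infdist (fst p - (snd p + real i * \<alpha>)) \<int> < 1 / real i \<and> snd p + real i * \<alpha> \<in> D l} :: (real \<times> real) set"
  have B [measurable]: "?B i \<in> sets (lborel \<Otimes>\<^sub>M lborel)" for i
  proof -
    have "{p\<in>space (borel \<Otimes>\<^sub>M borel). fst p \<in> {0..<1} \<and> snd p \<in> {0..<1} \<and>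
     infdist (fst p - (snd p + real i * \<alpha>)) \<int> < 1 / real i \<and> snd p + real i * \<alpha> \<in> D l} \<in> sets (borel \<Otimes>\<^sub>M borel)"
      by measurable
    moreover have "sets (lborel \<Otimes>\<^sub>M lborel) = sets (borel \<Otimes>\<^sub>M borel :: (real \<times> real) measure)"
      by (intro sets_pair_measure_cong sets_lborel)
    ultimately show ?thesis
      by (simp only: space_pair_measure space_borel UNIV_Times_UNIV UNIV_I simp_thms)
  qed
  have eq: "A l = (\<Union>i\<in>{1..R (Suc l)}. ?B i)" by (auto simp: A_def)
  show "A l \<in> sets (lborel \<Otimes>\<^sub>M lborel)" unfolding eq by measurable
  \<comment> \<open>For i = 0 the radius 1/0 is 0, so the set is empty and the bound is 0.\<close>
  have "emeasure (lborel \<Otimes>\<^sub>M lborel) (?B i) \<le> ennreal (2 / real i * err_meas l)" for i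
  proof -
    let ?E = "{x\<in>{0..<1}. x + real i * \<alpha> \<in> D l}"
    have "emeasure (lborel \<Otimes>\<^sub>M lborel) (?B i) = (\<integral>\<^sup>+x. emeasure lborel ((\<lambda>y. (y, x)) -` ?B i) \<partial>lborel)"
      by (rule lborel_pair.emeasure_pair_measure_alt2[OF B])
    also have "\<dots> \<le> (\<integral>\<^sup>+x. ennreal (2 / real i) * indicator ?E x \<partial>lborel)"
    proof (rule nn_integral_mono)
      fix x
      show "emeasure lborel ((\<lambda>y. (y, x)) -` ?B i) \<le> ennreal (2 / real i) * indicator ?E x"
      proof (cases "x \<in> ?E")
        case True
        then have "(\<lambda>y. (y, x)) -` ?B i = {y\<in>{0..<1}. infdist (y - (x + real i * \<alpha>)) \<int> < 1 / real i}" by auto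
        then show ?thesis using emeasure_near_le[of "1 / real i" "x + real i * \<alpha>"] True by simp
      next
        case False
        then have "(\<lambda>y. (y, x)) -` ?B i = {}" by auto
        then show ?thesis by (simp only: emeasure_empty zero_le)
      qed
    qed
    also have "\<dots> = ennreal (2 / real i) * emeasure lborel ?E"
      by (rule nn_integral_cmult_indicator) measurable
    also have "\<dots> \<le> ennreal (2 / real i) * ennreal (err_meas l)"
      by (intro mult_left_mono emeasure_D_le) simp
    also have "\<dots> = ennreal (2 / real i * err_meas l)" using err_meas_nonneg by (intro ennreal_mult[symmetric]) auto
    finally show ?thesis .
  qed
  then have "emeasure (lborel \<Otimes>\<^sub>M lborel) (\<Union>i\<in>{1..R (Suc l)}. ?B i)
      \<le> ennreal (\<Sum>i=1..R (Suc l). 2 / real i * err_meas l)"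
    using err_meas_nonneg B by (intro emeasure_UN_le) simp_all
  then show "emeasure (lborel \<Otimes>\<^sub>M lborel) (A l) \<le> ennreal ((\<Sum>i=1..R (Suc l). 2 / real i) * err_meas l)"
    unfolding eq by (simp add: sum_distrib_right)
qed

lemma AE_A: "AE y in lborel. AE x in lborel. \<forall>\<^sub>F l in sequentially. (y, x) \<notin> A l"
proof (rule lborel_pair.AE_pair)
  show "AE p in lborel \<Otimes>\<^sub>M lborel. \<forall>\<^sub>F l in sequentially. p \<notin> A l"
    by (rule borel_cantelli_bound[OF emeasure_A_le _ summable_hits])
       (auto intro!: mult_nonneg_nonneg sum_nonneg err_meas_nonneg)
qed

text \<open>For a late visit i in the window of k, \<open>A\<close> keeps
  \<open>x + i * \<alpha>\<close> out of every \<open>D l\<close> with l \<ge> k, so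
  \<open>H\<close> equals \<open>g k\<close> there. As y avoids \<open>G k\<close>,
  \<open>g k\<close> has the same value at y, and this is \<open>H y\<close> because y avoids the
  \<open>D l\<close> as well.\<close>

lemma hits_cocycle:
  assumes yx: "y \<in> {0..<1}" "x \<in> {0..<1}"
    and x: "regular x" and y: "\<forall>\<^sub>F l in sequentially. y \<notin> D l" "\<forall>\<^sub>F l in sequentially. y \<notin> G l"
    and A: "\<forall>\<^sub>F l in sequentially. (y, x) \<notin> A l"
  shows "\<forall>\<^sub>F i in sequentially. infdist (x + real i * \<alpha> - y) \<int> < 1 / real i \<longrightarrow>
    (\<Sum>j<i. jump s (x + real j * \<alpha>) - jump s (x + real j * \<alpha> - Y)) = H y - H x"
proof -
  obtain k0 where k0: "\<And>l. l \<ge> k0 \<Longrightarrow> y \<notin> D l \<and> y \<notin> G l \<and> (y, x) \<notin> A l"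
    using eventually_conj[OF y(1) eventually_conj[OF y(2) A]] unfolding eventually_sequentially by auto
  show ?thesis unfolding eventually_sequentially
  proof (intro exI allI impI)
    fix i assume i: "R k0 \<le> i" and hit: "infdist (x + real i * \<alpha> - y) \<int> < 1 / real i"
    \<comment> \<open>The window containing i. The greatest k exists because
      \<open>R k0 \<le> i\<close> and k < \<open>R k\<close>.\<close>
    define k where "k = (GREATEST k. R k \<le> i)"
    have bound: "\<forall>k. R k \<le> i \<longrightarrow> k \<le> i" using R_gt by (meson less_imp_le order_trans)
    have k: "R k \<le> i" unfolding k_def using GreatestI_nat[of "\<lambda>k. R k \<le> i", OF i] bound by blast
    have "k0 \<le> k" unfolding k_def using Greatest_le_nat[of "\<lambda>k. R k \<le> i", OF i] bound by blast
    have k_max: "i < R (Suc k)"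
    proof (rule ccontr)
      assume "\<not> i < R (Suc k)"
      then have "Suc k \<le> (GREATEST k. R k \<le> i)" using bound by (intro Greatest_le_nat[where b = i]) auto
      then have "Suc k \<le> k" by (simp only: k_def)
      then show False by simp
    qed
    have i1: "i \<ge> 1" using k R_ge_2[of k] by simp
    have "x + real i * \<alpha> \<notin> D l" if "l \<ge> k" for l
    proof
      assume "x + real i * \<alpha> \<in> D l"
      moreover have "i \<le> R (Suc l)" using k_max R_mono[of "Suc k" "Suc l"] that by simp
      ultimately have "(y, x) \<in> A l" using yx hit i1 infdist_Ints_minus_commute[of y]
        by (auto simp: A_def intro!: bexI[of _ i])
      then show False using k0[of l] that \<open>k0 \<le> k\<close> by simp
    qed
    then have "H (x + real i * \<alpha>) = g k (x + real i * \<alpha>)" by (simp add: g_eq_H)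
    also have "\<dots> = g k y"
    proof (rule g_eq_if_near)
      have "1 / real i \<le> 1 / real (R k)" using k R_ge_2[of k] by (intro divide_left_mono) auto
      then show "infdist (x + real i * \<alpha> - y) \<int> < 1 / real (R k)" using hit by simp
      show "y \<notin> G k" using k0 \<open>k0 \<le> k\<close> by simp
    qed
    also have "\<dots> = H y" using k0 \<open>k0 \<le> k\<close> by (intro g_eq_H) auto
    finally show "(\<Sum>j<i. jump s (x + real j * \<alpha>) - jump s (x + real j * \<alpha> - Y)) = H y - H x"
      unfolding H_iterate[OF x] by simp
  qed
qed
end

section \<open>The skew product\<close>

lemma bit_add_eq_0_iff: "j + v = 0 \<longleftrightarrow> j = (v :: bit)"
  by (cases "j = 0"; cases "v = 0"; simp)

lemma finite_UNIV_bit: "finite (UNIV :: bit set)"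
proof (rule finite_subset)
  show "(UNIV :: bit set) \<subseteq> {0, 1}" using bit_not_one_iff by blast
qed simp

context veech_skew
begin

text \<open>The minus sign makes this a sum of coboundary terms over the integers; modulo 2 it
  disappears, leaving the fibre displacement under i steps of \<open>skew_T\<close>.\<close>

definition cocycle :: "nat \<Rightarrow> real \<Rightarrow> int" where
  "cocycle i x = (\<Sum>j<i. jump s (x + real j * \<alpha>) - jump s (x + real j * \<alpha> - Y))"

lemma measurable_cocycle [measurable]: "cocycle i \<in> borel \<rightarrow>\<^sub>M count_space UNIV"
proof -
  have "(\<lambda>x. real_of_int (cocycle i x)) \<in> borel_measurable borel"
    unfolding cocycle_def of_int_sum of_int_diff by measurable
  then have "(\<lambda>x. \<lfloor>real_of_int (cocycle i x)\<rfloor>) \<in> borel \<rightarrow>\<^sub>M count_space UNIV" by measurable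
  then show ?thesis by (simp only: floor_of_int)
qed

text \<open>From 0 < s < \<alpha> \<le> Y and Y + s < 1, the arcs are disjoint and do not wrap
  around. The indicator of the union is thus a sum, which modulo 2 equals the difference.\<close>

lemma indicator_arcs:
  assumes "x \<in> {0..<1}"
  shows "(indicator (arc_J \<alpha> \<union> arc_J' \<alpha>) x :: bit) = of_int (jump s x - jump s (x - Y))"
proof -
  have bounds: "0 < s" "s < \<alpha>" "\<alpha> \<le> Y" "Y + s < 1"
    using s_bounds Y_bounds \<alpha> by linarith+
  have J: "arc_J \<alpha> = {0..<s}"
    using bounds by (simp add: arc_J_def s_def[symmetric] frac_eq[THEN iffD2])
  have "y_inf \<alpha> = Y" using bounds \<alpha> by (simp add: y_inf_def Y_def[symmetric] frac_eq)
  then have "arc_J' \<alpha> = (\<lambda>x. frac (Y + x)) ` {0..<s}" by (simp add: arc_J'_def J)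
  also have "\<dots> = (\<lambda>x. Y + x) ` {0..<s}"
    using bounds \<alpha> by (intro image_cong) (auto simp: frac_eq)
  also have "\<dots> = {Y..<Y + s}" by (simp add: add.commute)
  finally have J': "arc_J' \<alpha> = {Y..<Y + s}" .
  have f: "\<lfloor>u\<rfloor> = 0" if "0 \<le> u" "u < 1" for u :: real using that by (simp add: floor_eq_iff)
  have f': "\<lfloor>u\<rfloor> = -1" if "-1 \<le> u" "u < 0" for u :: real using that by (simp add: floor_eq_iff)
  have 1: "jump s x = of_bool (x < s)"
    using assms bounds by (auto simp: jump_def f f')
  consider "x < Y" | "Y \<le> x" "x < Y + s" | "Y + s \<le> x" by linarith
  then have 2: "jump s (x - Y) = of_bool (x \<in> {Y..<Y + s})"
    by cases (use assms bounds \<alpha> in \<open>auto simp: jump_def f f'\<close>)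
  show ?thesis unfolding J J' 1 2 indicator_def using assms bounds by auto
qed

lemma skew_T_funpow:
  assumes "x \<in> {0..<1}"
  shows "(skew_T \<alpha> ^^ i) (x, j) = (frac (x + real i * \<alpha>), j + of_int (cocycle i x))"
proof (induction i)
  case 0
  then show ?case using assms by (simp add: cocycle_def frac_eq)
next
  case (Suc i)
  let ?u = "x + real i * \<alpha>"
  have u: "frac ?u = ?u + of_int (- \<lfloor>?u\<rfloor>)" by (simp add: frac_def)
  have "frac ?u - Y = ?u - Y + of_int (- \<lfloor>?u\<rfloor>)" using u by simp
  then have "jump s (frac ?u) = jump s ?u" "jump s (frac ?u - Y) = jump s (?u - Y)"
    unfolding u by (simp_all only: jump_add_int)
  then have ind: "(indicator (arc_J \<alpha> \<union> arc_J' \<alpha>) (frac ?u) :: bit) = of_int (jump s ?u - jump s (?u - Y))"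
    using indicator_arcs[of "frac ?u"] by (simp add: frac_lt_1)
  have fr: "frac (frac ?u + \<alpha>) = frac (x + real (Suc i) * \<alpha>)"
  proof -
    have "frac (v + of_int k) = frac v" for v :: real and k by (simp add: frac_def)
    moreover have "frac ?u + \<alpha> = x + real (Suc i) * \<alpha> + of_int (- \<lfloor>?u\<rfloor>)"
      by (simp add: frac_def algebra_simps)
    ultimately show ?thesis by (simp only:)
  qed
  have "(skew_T \<alpha> ^^ Suc i) (x, j) = skew_T \<alpha> (frac ?u, j + of_int (cocycle i x))" using Suc by simp
  also have "\<dots> = (frac (frac ?u + \<alpha>), j + of_int (cocycle i x) + indicator (arc_J \<alpha> \<union> arc_J' \<alpha>) (frac ?u))"
    by (simp only: skew_T_def prod.case)
  also have "\<dots> = (frac (x + real (Suc i) * \<alpha>), j + of_int (cocycle (Suc i) x))"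
    unfolding fr ind by (simp only: cocycle_def sum.lessThan_Suc of_int_add add.assoc)
  finally show ?case .
qed

definition hit_set :: "real \<Rightarrow> nat \<Rightarrow> (real \<times> bit) set" where
  "hit_set y i = (skew_T \<alpha> ^^ i) -` fibre_ball (y, 0) (1 / real i) \<inter> space lambda2"

text \<open>Exactly one starting fibre leads into fibre 0, namely the one equal to the cocycle
  modulo 2.\<close>

lemma mem_hit_set:
  "(x, j) \<in> hit_set y i \<longleftrightarrow> x \<in> {0..<1} \<and> infdist (x + real i * \<alpha> - y) \<int> < 1 / real i \<and> j = of_int (cocycle i x)"
proof (cases "x \<in> {0..<1}")
  case True
  have "frac (x + real i * \<alpha>) - y = x + real i * \<alpha> - y + of_int (- \<lfloor>x + real i * \<alpha>\<rfloor>)"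
    by (simp add: frac_def)
  then have "infdist (frac (x + real i * \<alpha>) - y) \<int> = infdist (x + real i * \<alpha> - y) \<int>"
    by (simp only: infdist_Ints_add_int)
  moreover have "(x, j) \<in> hit_set y i \<longleftrightarrow>
      (frac (x + real i * \<alpha>), j + of_int (cocycle i x)) \<in> fibre_ball (y, 0) (1 / real i)"
    using True by (simp only: hit_set_def Int_iff vimage_eq skew_T_funpow[OF True] space_lambda2) simp
  ultimately show ?thesis using True
    by (auto simp: fibre_ball_def frac_lt_1 bit_add_eq_0_iff)
qed (auto simp: hit_set_def space_lambda2)

section \<open>Measurability and measure of the limsup set\<close>

lemma sets_hit_set: "hit_set y i \<in> sets lambda2"
proof -
  let ?X = "\<lambda>j. {x\<in>{0..<1}. infdist (x + real i * \<alpha> - y) \<int> < 1 / real i \<and> j = (of_int (cocycle i x) :: bit)}"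
  have "hit_set y i = (\<Union>j\<in>UNIV. ?X j \<times> {j})" by (auto simp: mem_hit_set)
  moreover have "?X j \<times> {j} \<in> sets lambda2" for j
  proof -
    have "?X j \<in> sets borel" by measurable
    then have "?X j \<in> sets (lebesgue_on {0..<1})"
      by (subst sets_restrict_space_iff) auto
    then show ?thesis unfolding lambda2_def by (intro pair_measureI) auto
  qed
  moreover have "countable (UNIV :: bit set)" by (intro countable_finite finite_UNIV_bit)
  ultimately show ?thesis by (simp only:) (intro sets.countable_UN'; auto)
qed

text \<open>Fubini: almost every fibre carries exactly one point, of counting measure 1.\<close>

lemma emeasure_eq_1:
  assumes "X \<in> sets lambda2" "AE x in lborel. x \<in> {0..<1} \<longrightarrow> (\<exists>v. Pair x -` X = {v})"
  shows "emeasure lambda2 X = 1"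
proof -
  interpret C: sigma_finite_measure "count_space (UNIV :: bit set)"
    by (intro sigma_finite_measure_count_space_finite finite_UNIV_bit)
  have "AE x in lebesgue_on {0..<1}. emeasure (count_space UNIV) (Pair x -` X) = 1"
    using AE_completion[OF assms(2)]
    by (subst AE_restrict_space_iff) (auto elim!: eventually_mono)
  then have "(\<integral>\<^sup>+x. emeasure (count_space UNIV) (Pair x -` X) \<partial>lebesgue_on {0..<1}) = (\<integral>\<^sup>+x. 1 \<partial>lebesgue_on {0..<1::real})"
    by (rule nn_integral_cong_AE)
  also have "\<dots> = 1" by (simp add: emeasure_restrict_space)
  finally show ?thesis
    using C.emeasure_pair_measure_alt[of X "lebesgue_on {0..<1}"] assms(1) by (simp add: lambda2_def)
qed

text \<open>All late visits share one cocycle value and there are infinitely many of them, so only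
  that fibre is met infinitely often.\<close>

lemma section_eq_singleton:
  assumes inf: "\<exists>\<^sub>\<infinity>i. 1 \<le> i \<and> infdist (x + real i * \<alpha> - y) \<int> < 1 / real i"
    and const: "\<forall>\<^sub>F i in sequentially. infdist (x + real i * \<alpha> - y) \<int> < 1 / real i \<longrightarrow> cocycle i x = c"
    and x: "x \<in> {0..<1}"
  shows "Pair x -` (\<Inter>n\<in>{1..}. \<Union>i\<in>{n..}. hit_set y i) = {of_int c}"
proof -
  obtain N where N: "\<And>i. i \<ge> N \<Longrightarrow> infdist (x + real i * \<alpha> - y) \<int> < 1 / real i \<Longrightarrow> cocycle i x = c"
    using const unfolding eventually_sequentially by blast
  have "(\<forall>n\<ge>1. \<exists>i\<ge>n. (x, j) \<in> hit_set y i) \<longleftrightarrow> j = of_int c" for j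
  proof
    assume "\<forall>n\<ge>1. \<exists>i\<ge>n. (x, j) \<in> hit_set y i"
    then obtain i where "i \<ge> max 1 N" "(x, j) \<in> hit_set y i" by (meson max.cobounded1)
    then show "j = of_int c" using N[of i] by (auto simp: mem_hit_set)
  next
    assume j: "j = of_int c"
    show "\<forall>n\<ge>1. \<exists>i\<ge>n. (x, j) \<in> hit_set y i"
    proof (intro allI impI)
      fix n :: nat
      obtain i where "i \<ge> max n N" "infdist (x + real i * \<alpha> - y) \<int> < 1 / real i"
        using inf unfolding INFM_nat_le by blast
      then show "\<exists>i\<ge>n. (x, j) \<in> hit_set y i" using N[of i] x j by (intro exI[of _ i]) (simp add: mem_hit_set)
    qed
  qed
  then show ?thesis
    by (intro set_eqI) (simp only: vimage_eq INT_iff UN_iff Ball_def Bex_def atLeast_iff singleton_iff)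
qed

text \<open>Only countably many x are excluded; the others satisfy the hypothesis of
  \<open>infinitely_many_hits\<close> for y - x.\<close>

lemma AE_nonresonant: "AE x in lborel. \<forall>i k. y - x \<noteq> of_int i * \<alpha> + of_int k"
proof -
  have "AE x in lborel. x \<notin> (\<lambda>(i, k). y - (of_int i * \<alpha> + of_int k)) ` (UNIV :: (int \<times> int) set)"
    by (intro AE_not_in countable_imp_null_set_lborel countable_image) auto
  then show ?thesis
  proof eventually_elim
    case (elim x)
    show ?case
    proof (intro allI notI)
      fix i k :: int
      assume "y - x = of_int i * \<alpha> + of_int k"
      then have "x = (\<lambda>(i, k). y - (of_int i * \<alpha> + of_int k)) (i, k)" by simp
      then show False using elim by blast
    qed
  qed
qed

lemma AE_emeasure_limsup_hit_set:
  "AE y in lborel. y \<in> {0..<1} \<longrightarrow> emeasure lambda2 (\<Inter>n\<in>{1..}. \<Union>i\<in>{n..}. hit_set y i) = 1"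
  using AE_G AE_D[of 0] AE_A
proof eventually_elim
  case (elim y)
  show ?case
  proof
    assume y: "y \<in> {0..<1}"
    have "AE x in lborel. x \<in> {0..<1} \<longrightarrow> (\<exists>v. Pair x -` (\<Inter>n\<in>{1..}. \<Union>i\<in>{n..}. hit_set y i) = {v})"
      using AE_regular elim(3) AE_nonresonant[of y]
    proof eventually_elim
      case x: (elim x)
      show ?case
      proof
        assume "x \<in> {0..<1}"
        have "\<exists>\<^sub>\<infinity>i::nat. 1 \<le> i \<and> infdist (real i * \<alpha> - (y - x)) \<int> < 1 / real i"
          using x(3) by (intro infinitely_many_hits irr) auto
        moreover have "real i * \<alpha> - (y - x) = x + real i * \<alpha> - y" for i by simp
        ultimately have hits: "\<exists>\<^sub>\<infinity>i::nat. 1 \<le> i \<and> infdist (x + real i * \<alpha> - y) \<int> < 1 / real i"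
          by (simp only:)
        have "\<forall>\<^sub>F i in sequentially. infdist (x + real i * \<alpha> - y) \<int> < 1 / real i \<longrightarrow> cocycle i x = H y - H x"
          unfolding cocycle_def using x elim(1,2) y \<open>x \<in> {0..<1}\<close> by (intro hits_cocycle) auto
        from section_eq_singleton[OF hits this \<open>x \<in> {0..<1}\<close>]
        show "\<exists>v. Pair x -` (\<Inter>n\<in>{1..}. \<Union>i\<in>{n..}. hit_set y i) = {v}" by blast
      qed
    qed
    moreover have "(\<Inter>n\<in>{1..}. \<Union>i\<in>{n..}. hit_set y i) \<in> sets lambda2"
      by (intro sets.countable_INT' sets.countable_UN') (auto simp: sets_hit_set)
    ultimately show "emeasure lambda2 (\<Inter>n\<in>{1..}. \<Union>i\<in>{n..}. hit_set y i) = 1"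
      by (intro emeasure_eq_1)
  qed
qed

end

theorem proposition5:
  fixes \<alpha> :: real
  assumes "\<alpha> \<notin> \<rat>" and "\<alpha> \<in> {0<..<1/3}" and "badly_approximable \<alpha>"
  shows "AE y in lebesgue_on {0..<1}.
    emeasure lambda2
      (\<Inter>n\<in>{1..}. \<Union>i\<in>{n..}. (skew_T \<alpha> ^^ i) -` fibre_ball (y, 0) (1 / real i) \<inter> space lambda2) = 1"
proof -
  interpret veech_skew \<alpha> using assms by unfold_locales
  \<comment> \<open>Passing to the completion turns the statement for Borel-Lebesgue measure into
    one for Lebesgue measure.\<close>
  show ?thesis
    using AE_completion[OF AE_emeasure_limsup_hit_set]
    by (subst AE_restrict_space_iff) (simp_all add: hit_set_def)
qed

end
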